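(* Let $r\ge 4$, $k\ge 2$ and $n>(r-1)k$ be integers and let $p\ge 1$ be a real number. Then \[ \lambda^{(p)}(Q_k^r(n))\le r!\left(\binom nr-k\binom{n/k}{r}\right)n^{-r/p}. \] If $k\mid n$, equality holds. If $k\nmid n$, the inequality is strict.
   Context: An $r$-graph is a pair $G=(V,E)$ with $V$ a finite set and $E$ a family of $r$-element subsets of $V$. For $x\in\mathbb R^V$ put $P_G(x)=r!\sum_{e\in E}\prod_{v\in e}x_v$. For real $p\ge1$ the $p$-spectral radius of $G$ is $\lambda^{(p)}(G)=\max\{P_G(x): \sum_{v\in V}|x_v|^p=1\}$. $Q_k^r(n)$ is the $r$-graph on $n$ vertices whose vertex set is partitioned into $k$ classes with sizes pairwise differing by at most one, and whose edges are precisely all $r$-subsets of the vertex set not contained in a single class. For real $x$ and a nonnegative integer $s$, $\binom{x}{s}=\frac{x(x-1)\cdots(x-s+1)}{s!}$. *)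

theory Defs
  imports "HOL-Analysis.Analysis" "HOL-Library.Disjoint_Sets"
begin

type_synonym 'a hypergraph = "'a set \<times> 'a set set"

definition uniform_hypergraph :: "nat \<Rightarrow> 'a hypergraph \<Rightarrow> bool" where
  "uniform_hypergraph r G \<longleftrightarrow>
     finite (fst G) \<and> (\<forall>e\<in>snd G. e \<subseteq> fst G \<and> card e = r)"

text \<open>Vectors indexed by the vertex set are functions on the whole vertex type; only their
  values on the vertex set matter.\<close>

definition hypergraph_poly :: "nat \<Rightarrow> 'a hypergraph \<Rightarrow> ('a \<Rightarrow> real) \<Rightarrow> real" where
  "hypergraph_poly r G x = fact r * (\<Sum>e\<in>snd G. \<Prod>v\<in>e. x v)"

text \<open>The supremum is a maximum whenever the vertex set is nonempty and \<open>p > 0\<close>: see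
  \<open>p_spectral_radius_attained\<close> below.\<close>

definition p_spectral_radius :: "nat \<Rightarrow> real \<Rightarrow> 'a hypergraph \<Rightarrow> real" where
  "p_spectral_radius r p G =
     Sup {hypergraph_poly r G x | x. (\<Sum>v\<in>fst G. \<bar>x v\<bar> powr p) = 1}"

text \<open>\<open>is_Q r k n G\<close> says that \<open>G\<close> is (a copy of) \<open>Q\<^sub>k\<^sup>r(n)\<close>, which is determined only up to
  isomorphism. The classes of a \<open>partition_on\<close> are nonempty, which excludes \<open>n < k\<close>; for
  \<open>n \<ge> k\<close> balancedness forces nonemptiness anyway.\<close>

definition is_Q :: "nat \<Rightarrow> nat \<Rightarrow> nat \<Rightarrow> 'a hypergraph \<Rightarrow> bool" where
  "is_Q r k n G \<longleftrightarrow>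
     finite (fst G) \<and> card (fst G) = n \<and>
     (\<exists>P. partition_on (fst G) P \<and> card P = k \<and>
          (\<forall>A\<in>P. \<forall>B\<in>P. card A \<le> card B + 1) \<and>
          snd G = {e. e \<subseteq> fst G \<and> card e = r \<and> \<not> (\<exists>A\<in>P. e \<subseteq> A)})"

lemma is_Q_uniform: "is_Q r k n G \<Longrightarrow> uniform_hypergraph r G"
  unfolding is_Q_def uniform_hypergraph_def by auto

lemma is_Q_exists:
  assumes "0 < k" "k \<le> n"
  shows "\<exists>G :: nat hypergraph. is_Q r k n G"
proof -
  define C where "C i = {v. v < n \<and> v mod k = i}" for i
  define P where "P = C ` {..<k}"
  have mem: "i \<in> C i" if "i < k" for i
    using that assms by (auto simp: C_def)
  have inj: "inj_on C {..<k}"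
  proof (rule inj_onI)
    fix i j assume ij: "i \<in> {..<k}" "j \<in> {..<k}" "C i = C j"
    then have "i \<in> C j" using mem by auto
    then show "i = j" using ij by (auto simp: C_def)
  qed
  have part: "partition_on {..<n} P"
  proof -
    have "{} \<notin> P" using mem by (force simp: P_def)
    then show ?thesis using assms by (auto simp: partition_on_def P_def C_def disjoint_def)
  qed
  have le: "card (C i) \<le> card (C j) + 1" if "i < k" "j < k" for i j
  proof -
    have fin: "finite (C j)" by (auto simp: C_def)
    let ?f = "\<lambda>v. v div k"
    have inj_div: "inj_on ?f (C i)" for i
      by (rule inj_onI) (metis (mono_tags, lifting) C_def div_mod_decomp mem_Collect_eq)
    have sub: "?f ` C i \<subseteq> insert 0 (Suc ` ?f ` C j)"
    proof
      fix q assume "q \<in> ?f ` C i"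
      then obtain v where v: "v < n" "v mod k = i" "q = v div k" by (auto simp: C_def)
      show "q \<in> insert 0 (Suc ` ?f ` C j)"
      proof (cases q)
        case (Suc q')
        have "v = q * k + i" using v by (metis div_mod_decomp)
        then have "q' * k + j < n" using Suc v \<open>j < k\<close> by auto
        then have "q' * k + j \<in> C j" using \<open>j < k\<close> by (auto simp: C_def)
        moreover have "(q' * k + j) div k = q'" using \<open>j < k\<close> by auto
        ultimately show ?thesis using Suc by force
      qed simp
    qed
    have "card (C i) = card (?f ` C i)" using card_image[OF inj_div] by simp
    also have "\<dots> \<le> card (insert 0 (Suc ` ?f ` C j))" using sub fin by (intro card_mono) auto
    also have "\<dots> \<le> Suc (card (Suc ` ?f ` C j))" by (rule card_insert_le_m1) auto
    also have "card (Suc ` ?f ` C j) \<le> card (C j)"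
      using fin by (metis card_image_le image_image)
    finally show ?thesis by simp
  qed
  have "is_Q r k n ({..<n}, {e. e \<subseteq> {..<n} \<and> card e = r \<and> \<not> (\<exists>A\<in>P. e \<subseteq> A)})"
    unfolding is_Q_def fst_conv snd_conv
  proof (intro conjI exI[of _ P])
    show "card P = k" using card_image[OF inj] by (simp add: P_def)
    show "\<forall>A\<in>P. \<forall>B\<in>P. card A \<le> card B + 1" using le by (auto simp: P_def)
  qed (use part in auto)
  then show ?thesis by blast
qed

lemma p_spectral_radius_attained:
  assumes G: "uniform_hypergraph r G" and ne: "fst G \<noteq> {}" and p: "p > 0"
  shows "\<exists>x. (\<Sum>v\<in>fst G. \<bar>x v\<bar> powr p) = 1 \<and> p_spectral_radius r p G = hypergraph_poly r G x"
    and "(\<Sum>v\<in>fst G. \<bar>y v\<bar> powr p) = 1 \<Longrightarrow> hypergraph_poly r G y \<le> p_spectral_radius r p G"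
proof -
  let ?V = "fst G"
  let ?N = "\<lambda>x. (\<Sum>v\<in>?V. \<bar>x v\<bar> powr p)"
  have fin: "finite ?V" using G by (simp add: uniform_hypergraph_def)
  define B where "B = (\<Pi>\<^sub>E v\<in>UNIV. if v \<in> ?V then {-1..1::real} else {0})"
  define K where "K = B \<inter> {x. ?N x = 1}"
  have "compactin (product_topology (\<lambda>_. euclidean) UNIV) B"
    unfolding B_def by (subst compactin_PiE) auto
  then have "compact B"
    by (metis compactin_euclidean_iff euclidean_product_topology)
  moreover have "closed {x. ?N x = 1}"
    by (intro closed_Collect_eq continuous_intros continuous_on_powr' continuous_on_product_coordinates)
       (use p in auto)
  ultimately have "compact K" unfolding K_def by (rule compact_Int_closed)
  have cont: "continuous_on K (hypergraph_poly r G)"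
    unfolding hypergraph_poly_def
    by (intro continuous_intros continuous_on_subset[OF continuous_on_product_coordinates]) auto
  obtain w where w: "w \<in> ?V" using ne by blast
  let ?u = "\<lambda>v. if v = w then 1 else (0::real)"
  have "?N ?u = (\<Sum>v\<in>?V. if v = w then 1 else 0)" by (intro sum.cong) auto
  then have "?u \<in> K" using w fin by (auto simp: K_def B_def)
  then obtain x where x: "x \<in> K" "\<And>y. y \<in> K \<Longrightarrow> hypergraph_poly r G y \<le> hypergraph_poly r G x"
    using continuous_attains_sup[OF \<open>compact K\<close> _ cont] by blast
  have up: "hypergraph_poly r G y \<le> hypergraph_poly r G x" if y: "?N y = 1" for y
  proof -
    let ?z = "\<lambda>v. if v \<in> ?V then y v else 0"
    have "\<bar>y v\<bar> \<le> 1" if "v \<in> ?V" for v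
    proof (rule ccontr)
      assume "\<not> \<bar>y v\<bar> \<le> 1"
      then have "1 < \<bar>y v\<bar> powr p" using p by (simp add: gr_one_powr)
      also have "\<dots> \<le> ?N y" using member_le_sum[of v ?V "\<lambda>v. \<bar>y v\<bar> powr p"] that fin by simp
      finally show False using y by simp
    qed
    then have "?z \<in> K" using y by (auto simp: K_def B_def abs_le_iff)
    moreover have "hypergraph_poly r G ?z = hypergraph_poly r G y"
      using G unfolding hypergraph_poly_def uniform_hypergraph_def
      by (intro arg_cong[of _ _ "(*) (fact r)"] sum.cong prod.cong) auto
    ultimately show ?thesis using x(2)[of ?z] by simp
  qed
  have "?N x = 1" using x by (simp add: K_def)
  then have eq: "p_spectral_radius r p G = hypergraph_poly r G x"
    unfolding p_spectral_radius_def using up by (intro cSup_eq_maximum) auto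
  show "\<exists>x. ?N x = 1 \<and> p_spectral_radius r p G = hypergraph_poly r G x"
    using eq \<open>?N x = 1\<close> by blast
  show "?N y = 1 \<Longrightarrow> hypergraph_poly r G y \<le> p_spectral_radius r p G"
    using eq up by simp
qed

end

theory Submission
  imports Defs
begin

text \<open>
  For every exponent \<open>p \<ge> 1\<close> the power mean inequality bounds \<open>\<Sum>\<bar>x v\<bar>\<close> by
  \<open>n powr (1 - 1/p)\<close>, so it suffices to bound the edge polynomial
  \<open>e\<^sub>r(V) - \<Sum>\<^sub>A e\<^sub>r(A)\<close> (sums over the classes \<open>A\<close>) for nonnegative \<open>x\<close> with \<open>\<Sum> x v = n\<close>.
  By Maclaurin's inequality, replacing \<open>x\<close> on a class by its mean does not decrease the polynomial,
  so \<open>x\<close> may be taken constant on classes. Newton's inequalities give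
  \<open>e\<^sub>r(V) \<le> (n choose r) (1 - d)^(r-1)\<close>, where \<open>d\<close> is the variance of \<open>x\<close> divided by \<open>n - 1\<close>.
  When the classes have two different sizes \<open>q\<close> and \<open>q + 1\<close>, uniform weights are not optimal: heavier
  weights on the smaller classes lower \<open>\<Sum>\<^sub>A e\<^sub>r(A)\<close>. This gain, bounded via the convexity of
  \<open>(m gchoose r) / m^r\<close> as a function of \<open>1 / m\<close>, is outweighed by the factor \<open>(1 - d)^(r-1)\<close>
  thanks to \<open>r^3 \<le> 16 \<cdot> 2^(r-2)\<close> for \<open>r \<ge> 4\<close>.
\<close>

section \<open>Elementary symmetric polynomials\<close>

definition esym :: "nat \<Rightarrow> 'a set \<Rightarrow> ('a \<Rightarrow> real) \<Rightarrow> real" where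
  "esym r A x = (\<Sum>e | e \<subseteq> A \<and> card e = r. \<Prod>v\<in>e. x v)"

lemma esym_0: "finite A \<Longrightarrow> esym 0 A x = 1"
proof -
  assume "finite A"
  then have "{e. e \<subseteq> A \<and> card e = 0} = {{}}" by (auto dest: finite_subset)
  then show ?thesis by (simp add: esym_def)
qed

lemma esym_gt_card: "finite A \<Longrightarrow> card A < r \<Longrightarrow> esym r A x = 0"
proof -
  assume "finite A" "card A < r"
  then have "card e \<noteq> r" if "e \<subseteq> A" for e
    using card_mono[OF \<open>finite A\<close> that] by simp
  then have "{e. e \<subseteq> A \<and> card e = r} = {}" by blast
  then show ?thesis unfolding esym_def by (simp only: sum.empty)
qed

lemma esym_nonneg: "(\<And>v. v \<in> A \<Longrightarrow> 0 \<le> x v) \<Longrightarrow> 0 \<le> esym r A x"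
  unfolding esym_def by (intro sum_nonneg prod_nonneg) auto

lemma esym_insert:
  assumes "finite A" "a \<notin> A"
  shows "esym (Suc r) (insert a A) x = esym (Suc r) A x + x a * esym r A x"
proof -
  let ?S = "\<lambda>r. {e. e \<subseteq> A \<and> card e = r}"
  have fin: "finite (?S r)" for r using assms by simp
  have finA: "finite e" if "e \<subseteq> A" for e using that assms finite_subset by auto
  have split: "{e. e \<subseteq> insert a A \<and> card e = Suc r} = ?S (Suc r) \<union> insert a ` ?S r"
  proof (intro subset_antisym subsetI)
    fix e assume e: "e \<in> {e. e \<subseteq> insert a A \<and> card e = Suc r}"
    show "e \<in> ?S (Suc r) \<union> insert a ` ?S r"
    proof (cases "a \<in> e")
      case True
      then have "e = insert a (e - {a})" "e - {a} \<in> ?S r" using e by auto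
      then show ?thesis by blast
    qed (use e in auto)
  qed (use assms finA in \<open>auto simp: card_insert_if\<close>)
  have inj: "inj_on (insert a) (?S r)"
    using assms(2) by (intro inj_onI) (auto dest: insert_ident[THEN iffD1, rotated 2])
  have "esym (Suc r) (insert a A) x
      = esym (Suc r) A x + (\<Sum>e\<in>insert a ` ?S r. \<Prod>v\<in>e. x v)"
    unfolding esym_def split using fin assms by (intro sum.union_disjoint) auto
  also have "(\<Sum>e\<in>insert a ` ?S r. \<Prod>v\<in>e. x v) = (\<Sum>e\<in>?S r. \<Prod>v\<in>insert a e. x v)"
    using inj by (simp add: sum.reindex)
  also have "\<dots> = (\<Sum>e\<in>?S r. x a * (\<Prod>v\<in>e. x v))"
    using assms finA by (intro sum.cong refl prod.insert) auto
  also have "\<dots> = x a * esym r A x" by (simp add: esym_def sum_distrib_left)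
  finally show ?thesis .
qed

lemma esym_cong: "(\<And>v. v \<in> A \<Longrightarrow> x v = y v) \<Longrightarrow> esym r A x = esym r A y"
  unfolding esym_def by (intro sum.cong prod.cong) auto

lemma esym_scale: "esym r A (\<lambda>v. c * x v) = c ^ r * esym r A x"
  unfolding esym_def sum_distrib_left by (intro sum.cong) (auto simp: prod.distrib)

lemma esym_const: 
  assumes "finite A" "\<And>v. v \<in> A \<Longrightarrow> x v = c"
  shows "esym r A x = real (card A choose r) * c ^ r"
proof -
  have "esym r A x = (\<Sum>e | e \<subseteq> A \<and> card e = r. c ^ r)"
    unfolding esym_def using assms(2) by (intro sum.cong) (auto simp: subset_iff)
  then show ?thesis using n_subsets[OF assms(1)] by simp
qed

text \<open>Log-concavity alone would allow internal zeros of the sequence; excluding them lets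
  \<open>log_concave_cross\<close> pass over vanishing terms.\<close>

lemma esym_Suc_eq_0:
  assumes "finite A" "\<And>v. v \<in> A \<Longrightarrow> 0 \<le> x v" "esym r A x = 0"
  shows "esym (Suc r) A x = 0"
  using assms
proof (induction A arbitrary: r rule: finite_induct)
  case empty
  then show ?case by (simp add: esym_gt_card)
next
  case (insert a A)
  have nn: "0 \<le> esym m A x" for m using insert.prems by (intro esym_nonneg) auto
  have "0 \<le> x a" using insert.prems by auto
  obtain m where m: "r = Suc m"
    using insert.prems insert.hyps esym_0[of "insert a A" x] by (cases r) auto
  have "esym r A x + x a * esym m A x = 0"
    using insert.prems(2) esym_insert[OF insert.hyps(1,2), of m x] by (simp add: m)
  then have "esym r A x = 0"
    using nn[of r] nn[of m] \<open>0 \<le> x a\<close> by (smt (verit) mult_nonneg_nonneg)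
  moreover from this have "esym (Suc r) A x = 0" using insert by auto
  ultimately show ?case using esym_insert[OF insert.hyps(1,2), of r x] by simp
qed

lemma esym_1: "finite A \<Longrightarrow> esym (Suc 0) A x = (\<Sum>v\<in>A. x v)"
  by (induction A rule: finite_induct) (auto simp: esym_insert esym_0 esym_gt_card)

lemma esym_2: "finite A \<Longrightarrow> 2 * esym 2 A x = (\<Sum>v\<in>A. x v)^2 - (\<Sum>v\<in>A. (x v)^2)"
proof (induction A rule: finite_induct)
  case (insert a A)
  then show ?case
    using esym_insert[OF insert.hyps(1,2), of 1 x]
    by (simp add: esym_1 numeral_2_eq_2 power2_eq_square algebra_simps)
qed (simp add: esym_gt_card)

text \<open>Sorting the \<open>r\<close>-sets by the size of their intersection with
  \<open>A\<close>; later used to isolate a single class.\<close>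

lemma esym_union:
  assumes "finite A" "finite B" "A \<inter> B = {}"
  shows "esym r (A \<union> B) x = (\<Sum>j\<le>r. esym j A x * esym (r - j) B x)"
  using assms
proof (induction A arbitrary: r rule: finite_induct)
  case empty
  have "(\<Sum>j\<le>r. esym j {} x * esym (r - j) B x) = (\<Sum>j\<le>r. if j = 0 then esym r B x else 0)"
    by (intro sum.cong) (auto simp: esym_0 esym_gt_card)
  then show ?case by simp
next
  case (insert a A)
  show ?case
  proof (cases r)
    case 0
    then show ?thesis using insert by (simp add: esym_0)
  next
    case (Suc m)
    have "esym (Suc m) (insert a A \<union> B) x = esym (Suc m) (A \<union> B) x + x a * esym m (A \<union> B) x"
      using insert by (simp add: esym_insert)
    also have "\<dots> = esym (Suc m) B x 
        + (\<Sum>j\<le>m. (esym (Suc j) A x + x a * esym j A x) * esym (m - j) B x)"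
      using insert
      by (simp add: sum.atMost_Suc_shift esym_0 sum.distrib sum_distrib_left algebra_simps
               del: sum.atMost_Suc)
    also have "\<dots> = (\<Sum>j\<le>Suc m. esym j (insert a A) x * esym (Suc m - j) B x)"
      using insert by (simp add: sum.atMost_Suc_shift esym_0 esym_insert del: sum.atMost_Suc)
    finally show ?thesis using Suc by simp
  qed
qed

section \<open>Normalised symmetric means: Newton and Maclaurin inequalities\<close>

definition esym_mean :: "nat \<Rightarrow> 'a set \<Rightarrow> ('a \<Rightarrow> real) \<Rightarrow> real" where
  "esym_mean r A x = esym r A x / real (card A choose r)"

text \<open>This is \<open>esym_insert\<close> after normalisation: ratios of neighbouring binomial
  coefficients become coefficients affine in \<open>r\<close>, so that the induction for Newton's
  inequality is a polynomial computation.\<close>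

lemma esym_mean_insert:
  assumes "finite A" "a \<notin> A" "r \<le> card A"
  shows "(card A + 1) * esym_mean (Suc r) (insert a A) x
       = (real (card A) - r) * esym_mean (Suc r) A x + (r + 1) * x a * esym_mean r A x"
proof -
  define N where "N = card A"
  have pos: "0 < real (N choose r)" "0 < real (Suc N choose Suc r)"
    using assms by (simp_all add: N_def zero_less_binomial_iff del: binomial_Suc_Suc)
  have 1: "real (Suc r) * real (Suc N choose Suc r) = real (Suc N) * real (N choose r)"
    using Suc_times_binomial_eq[of N r] unfolding of_nat_mult[symmetric] by (simp add: mult.commute)
  have 2: "real (Suc N choose Suc r) = real (N choose r) + real (N choose Suc r)" by simp
  have 3: "(real N - r) * real (N choose r) = (r + 1) * real (N choose Suc r)"
    using 1 2 by (simp add: algebra_simps)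
  have A: "(N + 1) * (esym r A x / real (Suc N choose Suc r)) = (r + 1) * esym_mean r A x"
  proof -
    have "(real N + 1) / real (Suc N choose Suc r) = (real r + 1) / real (N choose r)"
      using 1 pos by (simp add: frac_eq_eq algebra_simps del: binomial_Suc_Suc)
    then have "esym r A x * ((real N + 1) / real (Suc N choose Suc r)) = esym r A x * ((real r + 1) / real (N choose r))"
      by simp
    then show ?thesis by (simp add: esym_mean_def N_def[symmetric] mult.commute add.commute del: binomial_Suc_Suc)
  qed
  have B: "(N + 1) * (esym (Suc r) A x / real (Suc N choose Suc r)) = (real N - r) * esym_mean (Suc r) A x"
  \<comment> \<open>At \<open>r = N\<close> the coefficient \<open>N choose Suc r\<close> is 0 and
    cannot be cancelled, but both sides vanish.\<close>
  proof (cases "r = N")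
    case True
    then show ?thesis using assms by (simp add: esym_gt_card N_def)
  next
    case False
    then have "0 < real (N choose Suc r)" using assms by (simp add: N_def)
    moreover have "real (Suc N) * (N choose Suc r) = (real N - r) * real (Suc N choose Suc r)"
    proof -
      have "real (Suc N) * (N choose Suc r) = real (Suc N) * real (Suc N choose Suc r) - real (Suc N) * real (N choose r)"
        unfolding 2 by (simp add: algebra_simps)
      also have "\<dots> = (real N - r) * real (Suc N choose Suc r)"
        unfolding 1[symmetric] by (simp add: algebra_simps)
      finally show ?thesis .
    qed
    ultimately have "(real N + 1) / real (Suc N choose Suc r) = (real N - r) / real (N choose Suc r)"
      using pos by (simp add: frac_eq_eq algebra_simps del: binomial_Suc_Suc)
    then have "esym (Suc r) A x * ((real N + 1) / real (Suc N choose Suc r))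
        = esym (Suc r) A x * ((real N - r) / real (N choose Suc r))" by simp
    then show ?thesis by (simp add: esym_mean_def N_def[symmetric] mult.commute add.commute del: binomial_Suc_Suc)
  qed
  have "(card A + 1) * esym_mean (Suc r) (insert a A) x
     = (N + 1) * (esym (Suc r) A x / real (Suc N choose Suc r)) 
       + x a * ((N + 1) * (esym r A x / real (Suc N choose Suc r)))"
    using assms(1,2) by (simp add: esym_mean_def esym_insert N_def add_divide_distrib algebra_simps del: binomial_Suc_Suc)
  then show ?thesis unfolding A B by (simp add: N_def)
qed

text \<open>The inductive step of Newton's inequality when a variable \<open>x\<close> joins \<open>N\<close> others: \<open>b, c, d, e\<close> are
  the symmetric means of consecutive degrees \<open>j - 2, \<dots>, j + 1\<close>. The difference of the two sides is
  at least \<open>(d - x c)\<^sup>2\<close>.\<close>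
lemma newton_step:
  fixes b c d e x N j :: real
  assumes nn: "0 \<le> b" "0 \<le> c" "0 \<le> d" "0 \<le> e" "0 \<le> x"
    and lc: "b * d \<le> c^2" "c * e \<le> d^2" "b * e \<le> c * d" and j: "1 \<le> j" "j \<le> N"
  shows "((N + 2 - j) * c + (j - 1) * x * b) * ((N - j) * e + (j + 1) * x * d)
       \<le> ((N + 1 - j) * d + j * x * c)^2"
proof -
  have 1: "(N + 2 - j) * (N - j) * (c * e) \<le> (N + 2 - j) * (N - j) * d^2"
    using j lc by (intro mult_left_mono) auto
  have 2: "x * ((j - 1) * (N - j) * (b * e)) \<le> x * ((j - 1) * (N - j) * (c * d))"
    using j lc nn by (intro mult_left_mono) auto
  have 3: "x^2 * ((j - 1) * (j + 1) * (b * d)) \<le> x^2 * ((j - 1) * (j + 1) * c^2)"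
    using j lc by (intro mult_left_mono) auto
  have "0 \<le> (d - x * c)^2" by simp
  with 1 2 3 show ?thesis by (simp add: power2_eq_square algebra_simps)
qed

text \<open>The ratios \<open>q (Suc m) / q m\<close> of a log-concave sequence are nonincreasing,
  here cleared of denominators; \<open>zero\<close> covers the places where a ratio is
  undefined.\<close>

lemma log_concave_cross:
  fixes q :: "nat \<Rightarrow> real"
  assumes nn: "\<And>m. 0 \<le> q m" and lc: "\<And>m. q m * q (Suc (Suc m)) \<le> (q (Suc m))^2"
    and zero: "\<And>m. q m = 0 \<Longrightarrow> q (Suc m) = 0" and "i \<le> m"
  shows "q i * q (Suc m) \<le> q (Suc i) * q m"
  using \<open>i \<le> m\<close>
proof (induction m rule: dec_induct)
  case (step m)
  show ?case
  proof (cases "q m = 0")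
    case True
    then show ?thesis using zero by simp
  next
    case False
    then have pos: "0 < q m" using nn[of m] by simp
    have "q m * (q i * q (Suc (Suc m))) \<le> q i * (q (Suc m))^2"
      using mult_left_mono[OF lc[of m] nn[of i]] by (simp add: algebra_simps)
    also have "\<dots> \<le> q m * (q (Suc i) * q (Suc m))"
      using mult_right_mono[OF step.IH nn[of "Suc m"]] by (simp add: power2_eq_square algebra_simps)
    finally show ?thesis using pos by simp
  qed
qed simp

lemma esym_mean_0: "finite A \<Longrightarrow> esym_mean 0 A x = 1"
  by (simp add: esym_mean_def esym_0)

lemma esym_mean_1: "finite A \<Longrightarrow> esym_mean (Suc 0) A x = (\<Sum>v\<in>A. x v) / card A"
  by (simp add: esym_mean_def esym_1)

lemma esym_mean_gt_card: "finite A \<Longrightarrow> card A < r \<Longrightarrow> esym_mean r A x = 0"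
  by (simp add: esym_mean_def esym_gt_card)

lemma esym_mean_nonneg: "(\<And>v. v \<in> A \<Longrightarrow> 0 \<le> x v) \<Longrightarrow> 0 \<le> esym_mean r A x"
  by (simp add: esym_mean_def esym_nonneg)

lemma esym_eq_mean: "finite A \<Longrightarrow> esym r A x = (card A choose r) * esym_mean r A x"
  by (cases "card A < r") (auto simp: esym_mean_def esym_gt_card)

lemma esym_mean_Suc_eq_0:
  assumes "finite A" "\<And>v. v \<in> A \<Longrightarrow> 0 \<le> x v" "esym_mean r A x = 0"
  shows "esym_mean (Suc r) A x = 0"
proof -
  have "esym r A x = 0" using esym_eq_mean[OF assms(1), of r x] assms(3) by simp
  then have "esym (Suc r) A x = 0" using assms(1,2) by (intro esym_Suc_eq_0)
  then show ?thesis by (simp add: esym_mean_def)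
qed

text \<open>For nonnegative variables an induction on their number replaces the classical argument
  with real-rooted polynomials. The non-adjacent product \<open>b * e\<close> in
  \<open>newton_step\<close> is controlled by \<open>log_concave_cross\<close> for the smaller
  set.\<close>

lemma esym_mean_newton:
  assumes "finite A" "\<And>v. v \<in> A \<Longrightarrow> 0 \<le> x v"
  shows "esym_mean m A x * esym_mean (Suc (Suc m)) A x \<le> (esym_mean (Suc m) A x)^2"
  using assms
proof (induction A arbitrary: m rule: finite_induct)
  case empty
  then show ?case by (simp add: esym_mean_gt_card)
next
  case (insert a A)
  define N where "N = card A"
  define q where "q m = esym_mean m A x" for m
  define q' where "q' m = esym_mean m (insert a A) x" for m
  have nn: "0 \<le> q m" for m unfolding q_def using insert.prems by (intro esym_mean_nonneg) auto
  have lc: "q m * q (Suc (Suc m)) \<le> (q (Suc m))^2" for m unfolding q_def using insert by auto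
  have zero: "q m = 0 \<Longrightarrow> q (Suc m) = 0" for m
    unfolding q_def using insert by (intro esym_mean_Suc_eq_0) auto
  have rec: "(real N + 1) * q' (Suc r) = (real N - r) * q (Suc r) + (real r + 1) * x a * q r"
    if "r \<le> N" for r
    using esym_mean_insert[OF insert.hyps(1,2), of r x] that
    by (simp add: q_def q'_def N_def add.commute)
  show ?case
  proof (cases "N < Suc m")
    case True
    then show ?thesis using insert by (simp add: esym_mean_gt_card N_def)
  next
    case False
    \<comment> \<open>The mean of degree \<open>m - 1\<close>. The default 0 at \<open>m = 0\<close>
      is harmless, since its coefficient \<open>j - 1 = m\<close> is then 0.\<close>
    define b where "b = (case m of 0 \<Rightarrow> 0 | Suc i \<Rightarrow> q i)"
    have b: "0 \<le> b" "b * q (Suc m) \<le> (q m)^2" "b * q (Suc (Suc m)) \<le> q m * q (Suc m)"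
      using nn lc log_concave_cross[of q, OF nn lc zero] by (auto simp: b_def split: nat.split)
    have rec0: "(real N + 1) * q' m = (real N + 1 - m) * q m + m * x a * b"
    proof (cases m)
      case 0
      then show ?thesis using insert by (simp add: q_def q'_def esym_mean_0)
    next
      case (Suc i)
      then show ?thesis using rec[of i] False by (simp add: b_def)
    qed
    define j where "j = real m + 1"
    have "((real N + 2 - j) * q m + (j - 1) * x a * b) * ((N - j) * q (Suc (Suc m)) + (j + 1) * x a * q (Suc m))
        \<le> ((real N + 1 - j) * q (Suc m) + j * x a * q m)^2"
      using False b nn lc insert.prems by (intro newton_step) (auto simp: j_def)
    moreover have "(real N + 2 - j) * q m + (j - 1) * x a * b = (real N + 1) * q' m"
      unfolding rec0 by (simp add: j_def)
    moreover have "(N - j) * q (Suc (Suc m)) + (j + 1) * x a * q (Suc m) = (real N + 1) * q' (Suc (Suc m))"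
      using False by (subst rec) (auto simp: j_def algebra_simps)
    moreover have "(real N + 1 - j) * q (Suc m) + j * x a * q m = (real N + 1) * q' (Suc m)"
      using False by (subst rec) (auto simp: j_def)
    ultimately have "((real N + 1) * q' m) * ((real N + 1) * q' (Suc (Suc m))) \<le> ((real N + 1) * q' (Suc m))^2"
      by (simp only:)
    then have "(real N + 1)^2 * (q' m * q' (Suc (Suc m))) \<le> (real N + 1)^2 * (q' (Suc m))^2"
      by (simp add: power2_eq_square algebra_simps)
    then show ?thesis by (simp add: q'_def)
  qed
qed

lemma esym_mean_cross:
  assumes "finite A" "\<And>v. v \<in> A \<Longrightarrow> 0 \<le> x v" "i \<le> m"
  shows "esym_mean i A x * esym_mean (Suc m) A x \<le> esym_mean (Suc i) A x * esym_mean m A x"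
proof (rule log_concave_cross[where q = "\<lambda>m. esym_mean m A x"])
  show "0 \<le> esym_mean m A x" for m using assms(2) by (rule esym_mean_nonneg)
  show "esym_mean m A x * esym_mean (Suc (Suc m)) A x \<le> (esym_mean (Suc m) A x)^2" for m
    using assms(1,2) by (rule esym_mean_newton)
  show "esym_mean m A x = 0 \<Longrightarrow> esym_mean (Suc m) A x = 0" for m
    using assms(1,2) by (rule esym_mean_Suc_eq_0)
qed (rule assms)

text \<open>By \<open>esym_mean_cross\<close> with \<open>i = 0\<close>, raising the degree by one
  costs at most a factor equal to the arithmetic mean; this is iterated \<open>r\<close>
  times.\<close>

lemma maclaurin:
  assumes "finite A" "\<And>v. v \<in> A \<Longrightarrow> 0 \<le> x v"
  shows "esym r A x \<le> (card A choose r) * ((\<Sum>v\<in>A. x v) / card A)^r"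
proof -
  have "esym_mean r A x \<le> ((\<Sum>v\<in>A. x v) / card A)^r"
  proof (induction r)
    case 0
    then show ?case using assms by (simp add: esym_mean_0)
  next
    case (Suc r)
    have "esym_mean (Suc r) A x \<le> (\<Sum>v\<in>A. x v) / card A * esym_mean r A x"
      using esym_mean_cross[of A x 0 r] assms by (simp add: esym_mean_0 esym_mean_1)
    also have "\<dots> \<le> (\<Sum>v\<in>A. x v) / card A * ((\<Sum>v\<in>A. x v) / card A)^r"
      using Suc assms by (intro mult_left_mono divide_nonneg_nonneg sum_nonneg) auto
    finally show ?case by simp
  qed
  then show ?thesis unfolding esym_eq_mean[OF assms(1)] by (intro mult_left_mono) auto
qed

section \<open>Sharpening by the variance\<close>

lemma esym_mean_2:
  fixes x :: "'a \<Rightarrow> real"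
  assumes "finite A" "2 \<le> card A" "(\<Sum>v\<in>A. x v) = card A"
  shows "esym_mean 2 A x = 1 - (\<Sum>v\<in>A. (x v - 1)^2) / (card A * (real (card A) - 1))"
proof -
  define n where "n = real (card A)"
  have n: "2 \<le> n" using assms by (simp add: n_def)
  have c: "real (card A choose 2) = n * (n - 1) / 2"
    using assms(2) by (simp add: n_def choose_two real_of_nat_div of_nat_diff)
  have "(\<Sum>v\<in>A. (x v - 1)^2) = (\<Sum>v\<in>A. (x v)^2) - 2 * (\<Sum>v\<in>A. x v) + n"
    by (simp add: power2_diff sum.distrib sum_subtractf sum_distrib_left n_def)
  then have "2 * esym 2 A x = n * (n - 1) - (\<Sum>v\<in>A. (x v - 1)^2)"
    using esym_2[OF assms(1), of x] assms(3) by (simp add: n_def power2_eq_square algebra_simps)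
  then show ?thesis unfolding esym_mean_def c n_def[symmetric] using n
    by (simp add: field_simps)
qed

text \<open>By \<open>esym_mean_cross\<close> with \<open>i = 1\<close>, each degree after the first
  costs a factor \<open>1 - d\<close>, the ratio of the second symmetric mean to the first, which is
  1. From degree 1 to \<open>r\<close> there are \<open>r - 1\<close> such factors.\<close>

lemma esym_le_variance:
  fixes x :: "'a \<Rightarrow> real" and d :: real
  assumes "finite A" "\<And>v. v \<in> A \<Longrightarrow> 0 \<le> x v" "2 \<le> card A" "(\<Sum>v\<in>A. x v) = card A"
  defines "d \<equiv> (\<Sum>v\<in>A. (x v - 1)^2) / (card A * (real (card A) - 1))"
  shows "d \<le> 1" "0 < r \<Longrightarrow> esym r A x \<le> (card A choose r) * (1 - d)^(r - 1)"
proof -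
  have 2: "esym_mean 2 A x = 1 - d" unfolding d_def by (rule esym_mean_2) (use assms in auto)
  have d: "0 \<le> 1 - d" unfolding 2[symmetric] using assms by (intro esym_mean_nonneg) auto
  then show "d \<le> 1" by simp
  have 1: "esym_mean (Suc 0) A x = 1" using assms by (auto simp: esym_mean_1)
  have "esym_mean (Suc m) A x \<le> (1 - d)^m" for m
  proof (induction m)
    case (Suc m)
    have "esym_mean (Suc (Suc m)) A x \<le> (1 - d) * esym_mean (Suc m) A x"
      using esym_mean_cross[of A x 1 "Suc m"] assms(1,2) 1 2 by (simp add: numeral_2_eq_2)
    also have "\<dots> \<le> (1 - d) * (1 - d)^m" using Suc d by (intro mult_left_mono) auto
    finally show ?case by simp
  qed (simp add: 1)
  from this[of "r - 1"] show "0 < r \<Longrightarrow> esym r A x \<le> (card A choose r) * (1 - d)^(r - 1)"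
    unfolding esym_eq_mean[OF assms(1)] by (intro mult_left_mono) auto
qed

section \<open>Binomial coefficients divided by powers\<close>

text \<open>For \<open>m \<noteq> 0\<close> this is \<open>fact r * (m gchoose r) / m ^ r\<close>,
  as a product of factors affine in \<open>1 / m\<close>.\<close>

definition falling_ratio :: "nat \<Rightarrow> real \<Rightarrow> real" where
  "falling_ratio r m = (\<Prod>j<r. 1 - real j / m)"

lemma falling_ratio_0 [simp]: "falling_ratio 0 m = 1" by (simp add: falling_ratio_def)

lemma falling_ratio_Suc: "falling_ratio (Suc r) m = falling_ratio r m * (1 - real r / m)"
  by (simp add: falling_ratio_def)

lemma gbinomial_eq_falling_ratio: "m \<noteq> 0 \<Longrightarrow> (m gchoose r) = m ^ r * falling_ratio r m / fact r"
proof -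
  assume m: "m \<noteq> 0"
  have "(\<Prod>j<r. m - real j) = (\<Prod>j<r. m * (1 - real j / m))"
    using m by (intro prod.cong) (auto simp: field_simps)
  then show ?thesis
    by (simp add: gbinomial_prod_rev prod.distrib falling_ratio_def atLeast0LessThan)
qed

lemma falling_ratio_pos: "real r < m + 1 \<Longrightarrow> 0 < m \<Longrightarrow> 0 < falling_ratio r m"
  unfolding falling_ratio_def by (intro prod_pos) (auto simp: field_simps)

lemma falling_ratio_nonneg: "real r \<le> m + 1 \<Longrightarrow> 0 < m \<Longrightarrow> 0 \<le> falling_ratio r m"
  unfolding falling_ratio_def by (intro prod_nonneg) (auto simp: field_simps)

lemma falling_ratio_mono: "real r \<le> m + 1 \<Longrightarrow> 0 < m \<Longrightarrow> m \<le> m' \<Longrightarrow> falling_ratio r m \<le> falling_ratio r m'"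
  unfolding falling_ratio_def by (intro prod_mono) (auto simp: frac_le)

text \<open>Convexity of \<open>falling_ratio r\<close> as a function of \<open>1 / m\<close>, where each factor is affine and
  decreasing.\<close>
lemma falling_ratio_chord:
  fixes m m' l l' u :: real
  assumes "real r \<le> m + 1" "0 < m" "m \<le> m'" "0 \<le> l" "0 \<le> l'" "l + l' = 1"
    and u: "1 / u = l / m + l' / m'"
  shows "0 \<le> falling_ratio r u \<and> falling_ratio r u \<le> l * falling_ratio r m + l' * falling_ratio r m'"
  using assms(1)
proof (induction r)
  case 0
  then show ?case using assms by simp
next
  case (Suc r)
  let ?g = "\<lambda>m. 1 - real r / m"
  have IH: "0 \<le> falling_ratio r u" "falling_ratio r u \<le> l * falling_ratio r m + l' * falling_ratio r m'" using Suc by auto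
  have g: "?g u = l * ?g m + l' * ?g m'"
  proof -
    have "?g u = (l + l') - real r * (1 / u)" using assms(6) by simp
    also have "\<dots> = l * ?g m + l' * ?g m'" unfolding u by (simp add: algebra_simps)
    finally show ?thesis .
  qed
  have gm: "0 \<le> ?g m" "?g m \<le> ?g m'" using Suc.prems assms by (auto simp: frac_le)
  have gu: "0 \<le> ?g u" unfolding g using gm assms by (intro add_nonneg_nonneg mult_nonneg_nonneg) linarith+
  have fm: "falling_ratio r m \<le> falling_ratio r m'" using Suc.prems assms by (intro falling_ratio_mono) auto
  \<comment> \<open>A product of two convex combinations falls short of the combination of the
    products by \<open>l * l' * (b - a) * (d - c)\<close>, which is nonnegative here because both
    factors grow from \<open>m\<close> to \<open>m'\<close>.\<close>
  have alg: "(l * a + l' * b) * (l * c + l' * d) + l * l' * ((b - a) * (d - c))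
      = l * (a * c) * (l + l') + l' * (b * d) * (l + l')" for a b c d :: real
    by (simp add: algebra_simps)
  have "falling_ratio r u * ?g u \<le> (l * falling_ratio r m + l' * falling_ratio r m') * ?g u"
    using IH gu by (intro mult_right_mono) auto
  also have "\<dots> \<le> (l * falling_ratio r m + l' * falling_ratio r m') * ?g u + l * l' * ((falling_ratio r m' - falling_ratio r m) * (?g m' - ?g m))"
    using assms fm gm by simp
  also have "\<dots> = l * (falling_ratio r m * ?g m) * (l + l') + l' * (falling_ratio r m' * ?g m') * (l + l')"
    unfolding g by (rule alg)
  also have "\<dots> = l * (falling_ratio r m * ?g m) + l' * (falling_ratio r m' * ?g m')" using assms(6) by simp
  finally show ?case using IH gu by (simp add: falling_ratio_Suc)
qed

text \<open>Since \<open>1 / q - 1 / (q + 1) = 1 / (q * (q + 1))\<close>, this bounds a difference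
  quotient in the variable \<open>1 / m\<close>. The product rule yields slopes 0 to
  \<open>r + 1\<close>, with sum \<open>(r + 2) * (r + 1) / 2\<close>, and each accompanying product
  is at most the one that omits the smallest factor.\<close>

lemma falling_ratio_diff:
  fixes q r :: nat
  assumes "Suc r \<le> q"
  shows "0 < falling_ratio (Suc (Suc r)) (q + 1) - falling_ratio (Suc (Suc r)) q
    \<and> real q * (q + 1) * (falling_ratio (Suc (Suc r)) (q + 1) - falling_ratio (Suc (Suc r)) q)
       \<le> (r + 2) * (r + 1) / 2 * falling_ratio (Suc r) (q + 1)"
  using assms
proof (induction r)
  case 0
  then have "falling_ratio (Suc (Suc 0)) (q + 1) - falling_ratio (Suc (Suc 0)) q = 1 / (real q * (q + 1))"
    by (simp add: falling_ratio_Suc divide_simps) (simp add: algebra_simps)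
  then show ?case using 0 by (simp add: falling_ratio_Suc)
next
  case (Suc r)
  define D where "D = falling_ratio (Suc (Suc r)) (q + 1) - falling_ratio (Suc (Suc r)) q"
  define h where "h = falling_ratio (Suc (Suc r)) (q + 1)"
  define g where "g = 1 - real (Suc (Suc r)) / q"
  have q: "0 < real q" using Suc by simp
  have g0: "0 \<le> g" using Suc.prems by (simp add: g_def field_simps)
  have h0: "0 < h" unfolding h_def using Suc.prems by (intro falling_ratio_pos) auto
  have IH: "0 < D" "real q * (q + 1) * D \<le> (r + 2) * (r + 1) / 2 * falling_ratio (Suc r) (q + 1)"
    using Suc by (auto simp: D_def)
  \<comment> \<open>Discrete product rule: the old difference times the new factor at
    \<open>q\<close>, plus the old product at \<open>q + 1\<close> times the slope
    \<open>r + 2\<close>.\<close>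
  have rec: "real q * (q + 1) * (falling_ratio (Suc (Suc (Suc r))) (q + 1) - falling_ratio (Suc (Suc (Suc r))) q)
      = g * (real q * (q + 1) * D) + (r + 2) * h"
  proof -
    have inv: "real q * (q + 1) * (1 / q - 1 / (q + 1)) = 1"
      using q by (simp add: divide_simps)
    have "Q * (h * (1 - s * v) - f * (1 - s * w)) = (1 - s * w) * (Q * (h - f)) + s * h * (Q * (w - v))"
      for Q f s v w :: real by (simp add: algebra_simps)
    from this[of "real q * (q + 1)" "r + 2" "1 / (q + 1)" "falling_ratio (Suc (Suc r)) q" "1 / q"] show ?thesis
      unfolding falling_ratio_Suc[of "Suc (Suc r)"] D_def h_def g_def inv by (simp add: add.commute)
  qed
  have "0 < g * (real q * (q + 1) * D) + (r + 2) * h"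
    using g0 h0 IH(1) q by (intro add_nonneg_pos) auto
  then have "0 < real q * (q + 1) * (falling_ratio (Suc (Suc (Suc r))) (q + 1) - falling_ratio (Suc (Suc (Suc r))) q)"
    unfolding rec .
  then have pos: "0 < falling_ratio (Suc (Suc (Suc r))) (q + 1) - falling_ratio (Suc (Suc (Suc r))) q"
    using q by (auto dest: zero_less_mult_pos)
  have f0: "0 < falling_ratio (Suc r) (q + 1)" using Suc.prems by (intro falling_ratio_pos) auto
  have "g \<le> 1 - real (Suc r) / (q + 1)"
    using q by (simp add: g_def field_simps)
  then have gh: "g * falling_ratio (Suc r) (q + 1) \<le> h"
    unfolding h_def falling_ratio_Suc[of "Suc r"] using f0 by (simp add: mult.commute)
  have "g * (real q * (q + 1) * D) \<le> g * ((r + 2) * (r + 1) / 2 * falling_ratio (Suc r) (q + 1))"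
    using IH g0 by (intro mult_left_mono) auto
  also have "\<dots> = (r + 2) * (r + 1) / 2 * (g * falling_ratio (Suc r) (q + 1))" by simp
  also have "\<dots> \<le> (r + 2) * (r + 1) / 2 * h" using gh by (intro mult_left_mono) auto
  finally have "g * (real q * (q + 1) * D) + (r + 2) * h \<le> (Suc r + 2) * (Suc r + 1) / 2 * h"
    by (simp add: field_simps)
  then show ?case using pos unfolding rec h_def by simp
qed

text \<open>After removing the common factor \<open>1 - 1 / n\<close> and lowering \<open>n\<close>
  to \<open>2 * q + 1\<close>, the claim comes down to
  \<open>2 * Q^2 - Q - 2 \<ge> 0\<close>.\<close>

lemma falling_ratio_compare_base:
  fixes q :: nat and n :: real
  assumes "q \<ge> 3" "n \<ge> 2 * q + 1"
  shows "falling_ratio 3 (q + 1) * (1 - 1 / n) \<le> falling_ratio 4 n"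
proof -
  define Q where "Q = real q"
  have Q: "3 \<le> Q" "n \<ge> 2 * Q + 1" using assms by (auto simp: Q_def)
  have a: "(1 - 1 / (Q + 1)) * (1 - 2 / (Q + 1)) \<le> (1 - 2 / (2*Q+1)) * (1 - 3 / (2*Q+1))"
  proof -
    have "Q * (Q - 1) * (2*Q+1)^2 \<le> (2*Q-1) * (2*Q-2) * (Q+1)^2"
    proof -
      have "Q * (2*Q+1)^2 \<le> 2 * (2*Q-1) * (Q+1)^2"
      proof -
        have "3 * Q \<le> Q * Q" using Q by (intro mult_right_mono) auto
        then have "0 \<le> 2 * (Q * Q) - Q - 2" using Q by linarith
        also have "\<dots> = 2 * (2*Q-1) * (Q+1)^2 - Q * (2*Q+1)^2"
          by (simp add: power2_eq_square algebra_simps)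
        finally show ?thesis by simp
      qed
      then have "(Q - 1) * (Q * (2*Q+1)^2) \<le> (Q - 1) * (2 * (2*Q-1) * (Q+1)^2)"
        using Q by (intro mult_left_mono) auto
      then show ?thesis by (simp add: algebra_simps)
    qed
    moreover have "(1 - 1 / (Q + 1)) * (1 - 2 / (Q + 1)) = Q * (Q - 1) / (Q+1)^2"
      using Q by (simp add: field_simps power2_eq_square)
    moreover have "(1 - 2 / (2*Q+1)) * (1 - 3 / (2*Q+1)) = (2*Q-1) * (2*Q-2) / (2*Q+1)^2"
      using Q by (simp add: field_simps power2_eq_square)
    ultimately show ?thesis using Q by (simp add: divide_simps)
  qed
  have b: "(1 - 2 / (2*Q+1)) * (1 - 3 / (2*Q+1)) \<le> (1 - 2 / n) * (1 - 3 / n)"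
    using Q by (intro mult_mono diff_left_mono divide_left_mono mult_pos_pos) (auto simp: divide_simps)
  have "(1 - 1 / (Q + 1)) * (1 - 2 / (Q + 1)) * (1 - 1 / n) \<le> (1 - 2 / n) * (1 - 3 / n) * (1 - 1 / n)"
    using order_trans[OF a b] Q by (intro mult_right_mono) auto
  moreover have "falling_ratio 3 (q + 1) = (1 - 1 / (Q + 1)) * (1 - 2 / (Q + 1))"
    by (simp add: falling_ratio_def eval_nat_numeral Q_def add.commute)
  moreover have "falling_ratio 4 n = (1 - 2 / n) * (1 - 3 / n) * (1 - 1 / n)"
    by (simp add: falling_ratio_def eval_nat_numeral)
  ultimately show ?thesis by simp
qed

text \<open>Converts the slope bound of \<open>falling_ratio_diff\<close>, a product at
  \<open>q + 1\<close>, into a product at \<open>n\<close> with one more factor. Since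
  \<open>n\<close> is nearly twice \<open>q + 1\<close>, each further factor on the right dominates
  its partner on the left.\<close>

lemma falling_ratio_compare:
  fixes q r :: nat and n :: real
  assumes "r + 3 \<le> q" "n \<ge> 2 * q + 1" 
  shows "falling_ratio (r + 3) (q + 1) * (1 - 1 / n) \<le> falling_ratio (r + 4) n"
  using assms(1)
proof (induction r)
  case 0
  then show ?case using falling_ratio_compare_base assms(2) by simp
next
  case (Suc r)
  have IH: "falling_ratio (r + 3) (q + 1) * (1 - 1 / n) \<le> falling_ratio (r + 4) n" using Suc by simp
  have n: "0 < n" using assms by linarith
  have le: "1 - real (r + 3) / (q + 1) \<le> 1 - real (r + 4) / n"
  proof -
    have "real (r + 4) * (q + 1) \<le> (r + 3) * (2 * real q + 1)"
    proof -
      have "real 1 \<le> real ((r + 2) * q)" using Suc.prems by (intro of_nat_mono) simp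
      then show ?thesis by (simp add: algebra_simps)
    qed
    also have "\<dots> \<le> (r + 3) * n" using assms(2) by (intro mult_left_mono) auto
    finally show ?thesis using n by (simp add: field_simps)
  qed
  have nn: "0 \<le> 1 - real (r + 3) / (q + 1)" "0 \<le> falling_ratio (r + 4) n"
    using Suc.prems assms(2) by (auto simp: field_simps intro!: falling_ratio_nonneg)
  have "falling_ratio (r + 3) (q + 1) * (1 - 1 / n) * (1 - real (r + 3) / (q + 1))
      \<le> falling_ratio (r + 4) n * (1 - real (r + 4) / n)"
    using IH le nn by (intro mult_mono) auto
  also have "\<dots> = falling_ratio (Suc r + 4) n" using falling_ratio_Suc[of "r + 4" n] by simp
  also have "falling_ratio (r + 3) (q + 1) * (1 - 1 / n) * (1 - real (r + 3) / (q + 1))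
      = falling_ratio (Suc r + 3) (q + 1) * (1 - 1 / n)"
    using falling_ratio_Suc[of "r + 3" "real (q + 1)"] by simp
  finally show ?case .
qed

text \<open>Shifted so that the degree is \<open>r + 4\<close>. The constant is tight: equality at
  degree 4, and 125 against 128 at degree 5.\<close>

lemma cube_le_pow2: "(r + 4)^3 \<le> 16 * (2::nat)^(r + 2)"
proof (induction r)
  case (Suc r)
  have "(Suc r + 4)^3 \<le> 2 * (r + 4)^3"
    by (simp add: power3_eq_cube algebra_simps)
  then show ?case using Suc by simp
qed simp

section \<open>Two class sizes\<close>

text \<open>Here \<open>\<alpha>\<close> and \<open>\<beta>\<close> are the average weights over the \<open>k - t\<close> classes of size \<open>q\<close> and the \<open>t\<close> classes of
  size \<open>q + 1\<close>. In the left-hand side \<open>\<Sum>\<^sub>A e\<^sub>r(A)\<close> is replaced by its tangent at the point where all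
  classes have equal mass: expanding at uniform weights instead would be too weak.\<close>
lemma unbalanced_core:
  fixes r k q t :: nat and \<alpha> \<beta> d n \<theta> \<nu> :: real
  defines "n \<equiv> real k * q + t"
  defines "\<theta> \<equiv> real t / k"
  defines "\<nu> \<equiv> q + \<theta>"
  assumes r: "4 \<le> r" "r \<le> Suc q" and t: "0 < t" "t < k"
    and \<beta>: "0 \<le> \<beta>" and d: "d \<le> 1"
    and mean: "(real k - t) * (q * (\<alpha> - 1)) + t * ((q + 1) * (\<beta> - 1)) = 0"
    and var: "(real k - t) * (q * (\<alpha> - 1)^2) + t * ((q + 1) * (\<beta> - 1)^2) \<le> n * (n - 1) * d"
  shows "k * falling_ratio r \<nu> - ((real k - t) * (falling_ratio r q * (1 + r * (q * \<alpha> / \<nu> - 1)))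
           + t * (falling_ratio r (q + 1) * (1 + r * ((q + 1) * \<beta> / \<nu> - 1))))
       < k ^ r * falling_ratio r n * (1 - (1 - d)^(r - 1))"
proof -
  define K T Q R where "K = real k" and "T = real t" and "Q = real q" and "R = real r"
  define a b where "a = falling_ratio r Q" and "b = falling_ratio r (Q + 1)"
  \<comment> \<open>\<open>z = 0\<close> for uniform weights, \<open>z = 1\<close> for classes of equal mass.\<close>
  define z where "z = Q * (\<alpha> - 1) / \<theta>"
  have K: "2 \<le> K" "T + 1 \<le> K" and T: "1 \<le> T" and Q: "3 \<le> Q" and R: "4 \<le> R"
    using r t by (auto simp: K_def T_def Q_def R_def)
  have \<theta>: "0 < \<theta>" "\<theta> < 1" "K * \<theta> = T"
    using K T unfolding \<theta>_def K_def[symmetric] T_def[symmetric] by auto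
  have \<nu>: "\<nu> = Q + \<theta>" "0 < \<nu>" using \<theta> Q by (auto simp: \<nu>_def Q_def)
  have n: "n = K * \<nu>" "n = K * Q + T" using \<theta> by (auto simp: n_def \<nu> K_def Q_def T_def algebra_simps)
  have n2: "2 * Q + 1 \<le> n" 
  proof -
    have "2 * Q \<le> K * Q" using K Q by (intro mult_right_mono) auto
    then show ?thesis using T n(2) by simp
  qed
  \<comment> \<open>The mean condition leaves one free parameter \<open>z\<close>: relative to
    uniform weights, a small class gains mass \<open>\<theta> * z\<close> and a large one loses
    \<open>(1 - \<theta>) * z\<close>.\<close>
  have \<alpha>: "Q * (\<alpha> - 1) = \<theta> * z" using \<theta> by (simp add: z_def)
  have \<beta>': "(Q + 1) * (\<beta> - 1) = - (1 - \<theta>) * z"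
  proof -
    have "(K - T) * (Q * (\<alpha> - 1)) + T * ((Q + 1) * (\<beta> - 1)) = 0"
      using mean by (simp add: K_def T_def Q_def add.commute)
    then have "T * ((Q + 1) * (\<beta> - 1)) = T * (- (1 - \<theta>) * z)"
      unfolding \<alpha> \<theta>(3)[symmetric] by (simp add: algebra_simps)
    then show ?thesis using T by simp
  qed
  have y1: "Q * \<alpha> / \<nu> - 1 = \<theta> * (z - 1) / \<nu>"
    using \<alpha> \<nu> by (simp add: field_simps)
  have y2: "(Q + 1) * \<beta> / \<nu> - 1 = - (1 - \<theta>) * (z - 1) / \<nu>"
    using \<beta>' \<nu> by (simp add: field_simps)
  define E where "E = \<theta> * (1 - \<theta>)"
  have E: "0 < E" using \<theta> by (simp add: E_def)
  have ff_arg: "falling_ratio (Suc (Suc (r - 2))) = falling_ratio r" "falling_ratio (Suc (r - 2)) = falling_ratio (r - 1)" 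
    "real ((r - 2 + 2) * (r - 2 + 1)) = R * (R - 1)"
    using r by (auto simp: R_def Suc_diff_Suc numeral_2_eq_2)
  have D: "0 < b - a" "Q * (Q + 1) * (b - a) \<le> R * (R - 1) / 2 * falling_ratio (r - 1) (Q + 1)"
    using falling_ratio_diff[of "r - 2" q, unfolded ff_arg] r by (simp_all add: a_def b_def Q_def add.commute)
  \<comment> \<open>Interpolation is in \<open>1 / m\<close>, so the weights are the vertex
    fractions \<open>Q * (1 - \<theta>) / \<nu>\<close> and
    \<open>(Q + 1) * \<theta> / \<nu>\<close>. Passing to the class fractions
    \<open>1 - \<theta>\<close> and \<open>\<theta>\<close> produces the term
    \<open>E * (b - a) / \<nu>\<close>.\<close>
  have chord: "falling_ratio r \<nu> \<le> Q * (1 - \<theta>) / \<nu> * a + (Q + 1) * \<theta> / \<nu> * b"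
    unfolding a_def b_def
  proof (rule falling_ratio_chord[THEN conjunct2])
    show "Q * (1 - \<theta>) / \<nu> + (Q + 1) * \<theta> / \<nu> = 1"
      using \<nu> by (simp add: add_divide_distrib[symmetric]) (simp add: algebra_simps)
    show "1 / \<nu> = Q * (1 - \<theta>) / \<nu> / Q + (Q + 1) * \<theta> / \<nu> / (Q + 1)"
      using \<nu> Q by (simp add: add_divide_distrib[symmetric])
  qed (use r Q \<theta> \<nu> in \<open>auto simp: Q_def\<close>)
  also have "\<dots> = (1 - \<theta>) * a + \<theta> * b + E * (b - a) / \<nu>"
  proof -
    have Q': "Q = \<nu> - \<theta>" using \<nu> by simp
    show ?thesis unfolding Q' E_def using \<nu>(2) by (simp add: divide_simps) (simp add: algebra_simps)
  qed
  finally have chord': "falling_ratio r \<nu> \<le> (1 - \<theta>) * a + \<theta> * b + E * (b - a) / \<nu>" .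
  have "k * falling_ratio r \<nu> - ((real k - t) * (falling_ratio r q * (1 + r * (q * \<alpha> / \<nu> - 1)))
           + t * (falling_ratio r (q + 1) * (1 + r * ((q + 1) * \<beta> / \<nu> - 1))))
     = K * falling_ratio r \<nu> - ((K - T) * (a * (1 + R * (Q * \<alpha> / \<nu> - 1)))
           + T * (b * (1 + R * ((Q + 1) * \<beta> / \<nu> - 1))))"
    by (simp add: K_def T_def Q_def R_def a_def b_def add.commute)
  also have "\<dots> = K * (falling_ratio r \<nu> - ((1 - \<theta>) * (a * (1 + R * (Q * \<alpha> / \<nu> - 1)))
           + \<theta> * (b * (1 + R * ((Q + 1) * \<beta> / \<nu> - 1)))))"
    unfolding \<theta>(3)[symmetric] by (simp add: algebra_simps)
  also have "\<dots> = K * (falling_ratio r \<nu> - ((1 - \<theta>) * a + \<theta> * b) + R * (z - 1) * (E * (b - a) / \<nu>))"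
  proof -
    have "f - ((1 - h) * (x * (1 + R * (h * w / \<nu>))) + h * (y * (1 + R * (- (1 - h) * w / \<nu>))))
        = f - ((1 - h) * x + h * y) + R * w * (h * (1 - h) * (y - x) / \<nu>)" for f h x w y
      using \<nu>(2) by (simp add: divide_simps) (simp add: algebra_simps)
    then show ?thesis unfolding y1 y2 E_def by simp
  qed
  \<comment> \<open>The bound is linear in \<open>z\<close>: negative at uniform weights
    (\<open>z = 0\<close>), positive at equal class masses (\<open>z = 1\<close>).\<close>
  also have "\<dots> \<le> K * (E * (b - a) / \<nu> * (R * z - (R - 1)))"
  proof -
    have "f - u + R * (z - 1) * w \<le> w * (R * z - (R - 1))" if "f \<le> u + w" for f u w :: real
      using that by (simp add: algebra_simps)
    from this[OF chord'] show ?thesis by (rule mult_left_mono) (use K in simp)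
  qed
  also have "\<dots> < K * (K ^ (r - 1) * falling_ratio r n * (1 - (1 - d)^(r - 1)))"
  proof (intro mult_strict_left_mono)
    have nn1: "0 < n * (n - 1)" using n2 Q by simp
    have fpos: "0 < falling_ratio r n" using n2 r by (intro falling_ratio_pos) (auto simp: Q_def)
    \<comment> \<open>The variance hypothesis is rewritten in \<open>z\<close>: any shift of mass
      forces \<open>d\<close> to be at least a multiple of \<open>z^2\<close>.\<close>
    have "(real k - t) * (q * (\<alpha> - 1)^2) + t * ((q + 1) * (\<beta> - 1)^2)
        = (K - T) * (Q * (\<alpha> - 1)^2) + T * ((Q + 1) * (\<beta> - 1)^2)"
      by (simp add: K_def T_def Q_def)
    also have "\<dots> = (K - T) * (\<theta> * z)^2 / Q + T * (- (1 - \<theta>) * z)^2 / (Q + 1)"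
    proof -
      have "c * x^2 = (c * x)^2 / c" if "c \<noteq> 0" for c x :: real
        using that by (simp add: power2_eq_square)
      from this[of Q "\<alpha> - 1"] this[of "Q + 1" "\<beta> - 1"] show ?thesis
        unfolding \<alpha> \<beta>' using Q by simp
    qed
    also have "\<dots> = K * ((1 - \<theta>) * (\<theta> * z)^2 / Q + \<theta> * (- (1 - \<theta>) * z)^2 / (Q + 1))"
      unfolding \<theta>(3)[symmetric] by (simp add: algebra_simps)
    also have "(1 - \<theta>) * (\<theta> * z)^2 / Q + \<theta> * (- (1 - \<theta>) * z)^2 / (Q + 1)
        = E * z^2 * \<nu> / (Q * (Q + 1))"
      unfolding \<nu> E_def using Q by (simp add: power2_eq_square divide_simps) (simp add: algebra_simps)
    also have "K * \<dots> = n * (E * z^2 / (Q * (Q + 1)))" by (simp add: n(1))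
    finally have "n * (E * z^2 / (Q * (Q + 1))) \<le> n * ((n - 1) * d)"
      using var by (simp only: mult.assoc)
    then have d0: "E * z^2 / (Q * (Q + 1)) \<le> (n - 1) * d"
      by (rule mult_left_le_imp_le) (use n2 Q in linarith)
    moreover have "0 \<le> E * z^2 / (Q * (Q + 1))" using E Q by simp
    ultimately have "0 \<le> (n - 1) * d" by linarith
    then have "0 \<le> d" using n2 Q by (simp add: zero_le_mult_iff)
    show "E * (b - a) / \<nu> * (R * z - (R - 1)) < K ^ (r - 1) * falling_ratio r n * (1 - (1 - d)^(r - 1))"
    \<comment> \<open>For \<open>z \<le> 0\<close> no mass moves to the small classes: the left side
      is negative, the right side nonnegative.\<close>
    proof (cases "z \<le> 0")
      case True
      have "R * z \<le> 0" using True R by (simp add: mult_nonneg_nonpos)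
      then have "E * (b - a) / \<nu> * (R * z - (R - 1)) < 0"
        using E D \<nu> R by (intro mult_pos_neg) auto
      also have "0 \<le> K ^ (r - 1) * falling_ratio r n * (1 - (1 - d)^(r - 1))"
        using fpos K \<open>0 \<le> d\<close> d by (intro mult_nonneg_nonneg) (auto intro: power_le_one)
      finally show ?thesis .
    next
      case False
      \<comment> \<open>The part of \<open>d\<close> that the shift \<open>z\<close> alone
        forces.\<close>
      define e where "e = E * z^2 / (Q * (Q + 1) * (n - 1))"
      have e: "0 < e" using E Q False n2 by (auto simp: e_def)
      have ed: "e \<le> d" 
      proof -
        have "E * z^2 / (Q * (Q + 1)) / (n - 1) \<le> d"
          using d0 n2 Q by (subst pos_divide_le_eq) (auto simp only: mult.commute)
        then show ?thesis by (simp add: e_def)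
      qed
      \<comment> \<open>\<open>\<beta> \<ge> 0\<close> caps \<open>(1 - \<theta>) * z\<close> at
        \<open>Q + 1\<close>. The value 1/3 makes \<open>1 - 3 * e + e^2\<close> positive, as needed
        for \<open>(1 - e)^3 < 1 - 2 * e\<close>.\<close>
      have e3: "e \<le> 1 / 3"
      proof -
        have "(1 - \<theta>) * z \<le> Q + 1"
        proof -
          have "0 \<le> (Q + 1) * \<beta>" using \<beta> Q by simp
          also have "\<dots> = (Q + 1) * (\<beta> - 1) + (Q + 1)" by (simp add: algebra_simps)
          finally show ?thesis unfolding \<beta>' by (simp add: algebra_simps)
        qed
        then have "((1 - \<theta>) * z)^2 \<le> (Q + 1)^2"
          using False \<theta> by (intro power_mono) auto
        then have "3 * T * ((1 - \<theta>) * z)^2 \<le> 3 * T * (Q + 1)^2"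
          using T by (intro mult_left_mono) auto
        also have "\<dots> = 3 * (T * (Q + 1)) * (Q + 1)" by (simp add: power2_eq_square)
        also have "\<dots> \<le> Q * ((K - T) * (n - 1)) * (Q + 1)"
        proof (rule mult_right_mono, rule mult_mono)
          have "(T + 1) * Q \<le> K * Q" using K Q by (intro mult_right_mono) auto
          then have "T * (Q + 1) \<le> 1 * (n - 1)" using n(2) Q by (simp add: algebra_simps)
          also have "\<dots> \<le> (K - T) * (n - 1)" using K n2 Q by (intro mult_right_mono) auto
          finally show "T * (Q + 1) \<le> (K - T) * (n - 1)" .
        qed (use Q T in auto)
        finally have "3 * T * ((1 - \<theta>) * z)^2 \<le> (K - T) * (Q * (Q + 1) * (n - 1))"
          by (simp add: algebra_simps)
        moreover have "3 * T * ((1 - \<theta>) * z)^2 = (K - T) * (3 * (E * z^2))"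
          unfolding \<theta>(3)[symmetric] E_def by (simp add: power2_eq_square algebra_simps)
        ultimately have "3 * (E * z^2) \<le> Q * (Q + 1) * (n - 1)" using K by simp
        then show ?thesis using Q n2 by (simp add: e_def divide_simps)
      qed
      have "(1 - d)^(r - 1) \<le> (1 - e)^(r - 1)" using ed d by (intro power_mono) auto
      also have "\<dots> \<le> (1 - e)^3" using e e3 r by (intro power_decreasing) auto
      also have "\<dots> < 1 - 2 * e"
      proof -
        have "0 < e * (1 - 3 * e + e^2)" using e e3 by (intro mult_pos_pos add_nonneg_pos) auto
        then show ?thesis by (simp add: power3_eq_cube power2_eq_square algebra_simps)
      qed
      finally have gain: "2 * e < 1 - (1 - d)^(r - 1)" by simp
      \<comment> \<open>AM-GM, tight at \<open>z = 2 * (R - 1) / R\<close>, turns the linear gain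
        into a multiple of \<open>z^2\<close>, comparable with \<open>e\<close>.\<close>
      have "R * z - (R - 1) \<le> R^2 * z^2 / (4 * (R - 1))"
      proof -
        have "0 \<le> (R * z - 2 * (R - 1))^2" by simp
        then show ?thesis using R by (simp add: power2_eq_square field_simps)
      qed
      then have "E * (b - a) / \<nu> * (R * z - (R - 1)) \<le> E * (b - a) / \<nu> * (R^2 * z^2 / (4 * (R - 1)))"
        using E D \<nu> by (intro mult_left_mono) auto
      also have "\<dots> = E * z^2 * R^2 / (4 * (R - 1) * \<nu> * (Q * (Q + 1))) * (Q * (Q + 1) * (b - a))"
        using Q by (simp add: mult_ac)
      also have "\<dots> \<le> E * z^2 * R^2 / (4 * (R - 1) * \<nu> * (Q * (Q + 1))) * (R * (R - 1) / 2 * falling_ratio (r - 1) (Q + 1))"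
        using D E R Q \<nu> by (intro mult_left_mono divide_nonneg_nonneg) auto
      also have "\<dots> = e * K * (R ^ 3 / 8) * (falling_ratio (r - 1) (Q + 1) * (1 - 1 / n))"
      proof -
        have "E * z^2 / (Q * (Q + 1)) = e * (n - 1)" using n2 Q by (simp add: e_def)
        moreover have "(n - 1) / \<nu> = K * (1 - 1 / n)" using \<nu>(2) K by (simp add: n(1) field_simps)
        moreover have "E * z^2 * R^2 / (4 * (R - 1) * \<nu> * (Q * (Q + 1))) * (R * (R - 1) / 2 * falling_ratio (r - 1) (Q + 1))
          = (E * z^2 / (Q * (Q + 1))) / \<nu> * (R^3 / 8) * falling_ratio (r - 1) (Q + 1)"
          using R by (simp add: power3_eq_cube power2_eq_square divide_simps) (simp add: algebra_simps)
        moreover from calculation have "E * z^2 / (Q * (Q + 1)) / \<nu> = e * (K * (1 - 1 / n))"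
          by (metis times_divide_eq_right)
        ultimately show ?thesis by (simp only: mult_ac)
      qed
      \<comment> \<open>The factor \<open>1 - 1 / n\<close>, which arose from
        \<open>(n - 1) / \<nu>\<close>, is the one that \<open>falling_ratio_compare\<close>
        absorbs.\<close>
      also have "\<dots> \<le> e * K * (R ^ 3 / 8) * falling_ratio r n"
        using falling_ratio_compare[of "r - 4" q n] r n2 e K R
        by (intro mult_left_mono) (auto simp: Q_def add.commute)
      also have "\<dots> \<le> e * K * (2 * K ^ (r - 2)) * falling_ratio r n"
      proof -
        have "R ^ 3 \<le> 16 * 2 ^ (r - 2)"
          using of_nat_mono[OF cube_le_pow2[of "r - 4"], where ?'a = real] r by (simp add: R_def Suc_diff_Suc numeral_eq_Suc)
        also have "\<dots> \<le> 16 * K ^ (r - 2)" using K by (simp add: power_mono)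
        finally show ?thesis using e K fpos by (intro mult_right_mono mult_left_mono) auto
      qed
      also have "\<dots> = K ^ (r - 1) * falling_ratio r n * (2 * e)"
        using r power_Suc[of K "r - 2"] by (simp add: Suc_diff_Suc numeral_2_eq_2)
      also have "\<dots> < K ^ (r - 1) * falling_ratio r n * (1 - (1 - d)^(r - 1))"
        using gain fpos K by (intro mult_strict_left_mono) auto
      finally show ?thesis .
    qed
  qed (use K in auto)
  also have "\<dots> = k ^ r * falling_ratio r n * (1 - (1 - d)^(r - 1))"
    using power_Suc[of K "r - 1"] r by (simp add: K_def)
  finally show ?thesis .
qed

text \<open>Binomial form of \<open>unbalanced_core\<close>: with tangent points
  \<open>\<nu> / q\<close> and \<open>\<nu> / (q + 1)\<close>, every term carries the common factor
  \<open>\<nu> ^ r / fact r\<close>.\<close>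

lemma unbalanced_bound:
  fixes r k q t n :: nat and \<alpha> \<beta> d \<nu> :: real
  defines "n \<equiv> k * q + t"
  defines "\<nu> \<equiv> real n / k"
  assumes r: "4 \<le> r" "r \<le> Suc q" and t: "0 < t" "t < k"
    and \<beta>: "0 \<le> \<beta>" and d: "d \<le> 1"
    and mean: "(real k - t) * (q * (\<alpha> - 1)) + t * ((q + 1) * (\<beta> - 1)) = 0"
    and var: "(real k - t) * (q * (\<alpha> - 1)^2) + t * ((q + 1) * (\<beta> - 1)^2) \<le> n * (real n - 1) * d"
  shows "(n choose r) * (1 - d)^(r - 1)
       - ((real k - t) * ((q choose r) * ((\<nu> / q)^r * (1 + r * (q * \<alpha> / \<nu> - 1))))
          + t * (((q + 1) choose r) * ((\<nu> / (q + 1))^r * (1 + r * ((q + 1) * \<beta> / \<nu> - 1)))))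
       < (n choose r) - k * (\<nu> gchoose r)"
proof -
  have q: "0 < q" and q1: "0 < q + 1" using r by auto
  have \<nu>: "\<nu> = q + real t / k" "0 < \<nu>" "real n = k * \<nu>" "real n = real k * q + t"
    using t q by (auto simp: \<nu>_def n_def field_simps intro!: add_pos_pos)
  have cn: "real (n choose r) = \<nu> ^ r / fact r * (k ^ r * falling_ratio r n)"
    using \<nu> t by (simp add: binomial_gbinomial gbinomial_eq_falling_ratio power_mult_distrib)
  have cm: "(m choose r) * ((\<nu> / m)^r * x) = \<nu> ^ r / fact r * (falling_ratio r m * x)" if "0 < m" for m :: nat and x :: real
    using that by (simp add: binomial_gbinomial gbinomial_eq_falling_ratio power_divide)
  have cnu: "\<nu> gchoose r = \<nu> ^ r / fact r * falling_ratio r \<nu>" using \<nu> by (simp add: gbinomial_eq_falling_ratio)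
  have "\<nu> ^ r / fact r * (k * falling_ratio r \<nu> - ((real k - t) * (falling_ratio r q * (1 + r * (q * \<alpha> / \<nu> - 1)))
           + t * (falling_ratio r (q + 1) * (1 + r * ((q + 1) * \<beta> / \<nu> - 1)))))
       < \<nu> ^ r / fact r * (k ^ r * falling_ratio r n * (1 - (1 - d)^(r - 1)))"
    unfolding \<nu>(1,4) 
    by (intro mult_strict_left_mono unbalanced_core) 
       (use r t \<beta> d mean var \<nu> in auto)
  moreover have "c * A * g - (u * (c * X) + v * (c * Y)) < c * A - w * (c * f)"
    if "c * (w * f - (u * X + v * Y)) < c * (A * (1 - g))" for c A g u X v Y w f :: real
    using that by (simp add: algebra_simps)
  ultimately show ?thesis unfolding cn cnu cm[OF q] cm[OF q1] by blast
qed

section \<open>The edge polynomial of a complete multi-class hypergraph\<close>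

definition cross_poly :: "nat \<Rightarrow> 'a set \<Rightarrow> 'a set set \<Rightarrow> ('a \<Rightarrow> real) \<Rightarrow> real" where
  "cross_poly r V P x = esym r V x - (\<Sum>A\<in>P. esym r A x)"

text \<open>Since \<open>0 < r\<close>, an \<open>r\<close>-set inside a class is nonempty and lies
  in exactly one class, so subtracting class by class removes it once.\<close>

lemma hypergraph_poly_eq_cross_poly:
  assumes V: "finite V" and P: "partition_on V P" and r: "0 < r"
  shows "hypergraph_poly r (V, {e. e \<subseteq> V \<and> card e = r \<and> \<not> (\<exists>A\<in>P. e \<subseteq> A)}) x
       = fact r * cross_poly r V P x"
proof -
  let ?S = "\<lambda>A. {e. e \<subseteq> A \<and> card e = r}"
  let ?E = "{e. e \<subseteq> V \<and> card e = r \<and> \<not> (\<exists>A\<in>P. e \<subseteq> A)}"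
  have AV: "A \<subseteq> V" if "A \<in> P" for A using P that by (auto simp: partition_on_def)
  have fin: "finite P" using V P by (rule finite_elements)
  have finS: "finite (?S A)" if "A \<subseteq> V" for A using that V finite_subset[of A V] by auto
  have disj: "?S A \<inter> ?S B = {}" if "A \<in> P" "B \<in> P" "A \<noteq> B" for A B
  proof -
    have "A \<inter> B = {}" using P that by (auto simp: partition_on_def disjoint_def)
    have "e \<notin> ?S B" if e: "e \<in> ?S A" for e
    proof
      assume "e \<in> ?S B"
      then have "e \<subseteq> A \<inter> B" using e by simp
      then show False using e r \<open>A \<inter> B = {}\<close> by simp
    qed
    then show ?thesis by (simp only: disjoint_iff) simp
  qed
  have "?S V = ?E \<union> (\<Union>A\<in>P. ?S A)" using AV by blast
  then have "esym r V x = (\<Sum>e\<in>?E. \<Prod>v\<in>e. x v) + (\<Sum>e\<in>(\<Union>A\<in>P. ?S A). \<Prod>v\<in>e. x v)"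
    unfolding esym_def using V fin finS AV by (simp only:) (intro sum.union_disjoint, auto)
  also have "(\<Sum>e\<in>(\<Union>A\<in>P. ?S A). \<Prod>v\<in>e. x v) = (\<Sum>A\<in>P. esym r A x)"
    unfolding esym_def using fin finS AV disj by (intro sum.UNION_disjoint) auto
  finally show ?thesis by (simp add: hypergraph_poly_def cross_poly_def)
qed

section \<open>Reduction to weights constant on classes\<close>

lemma finite_class: "finite V \<Longrightarrow> partition_on V P \<Longrightarrow> A \<in> P \<Longrightarrow> finite A"
  by (metis Union_upper finite_subset partition_onD1)

lemma sum_partition_on:
  assumes "finite V" "partition_on V P"
  shows "(\<Sum>v\<in>V. f v) = (\<Sum>A\<in>P. \<Sum>v\<in>A. f v)"
proof -
  have V: "V = \<Union>P" using assms(2) by (simp add: partition_on_def)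
  have "\<forall>A\<in>P. finite A" using finite_class[OF assms] by blast
  moreover have "\<forall>A\<in>P. \<forall>B\<in>P. A \<noteq> B \<longrightarrow> A \<inter> B = {}"
    using assms(2) by (auto simp: partition_on_def disjoint_def)
  ultimately show ?thesis unfolding V by (subst sum.Union_disjoint) auto
qed

text \<open>Edges are sorted by their number \<open>j\<close> of vertices in \<open>A\<close>. The
  subtraction cancels \<open>j = r\<close>; every other term is \<open>esym j A\<close> times a
  nonnegative quantity unaffected by averaging, so \<open>maclaurin\<close> applies
  termwise.\<close>

lemma cross_poly_le_average:
  assumes V: "finite V" and P: "partition_on V P" and A: "A \<in> P"
    and x: "\<And>v. v \<in> V \<Longrightarrow> 0 \<le> x v"
  defines "m \<equiv> (\<Sum>v\<in>A. x v) / card A"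
  defines "y \<equiv> \<lambda>v. if v \<in> A then m else x v"
  shows "cross_poly r V P x \<le> cross_poly r V P y"
proof -
  have AV: "A \<subseteq> V" using P A by (auto simp: partition_on_def)
  have fA: "finite A" "finite (V - A)" using AV V finite_subset by auto
  have fP: "finite P" using V P by (rule finite_elements)
  have split: "cross_poly r V P z = (\<Sum>j<r. esym j A z * esym (r - j) (V - A) z)
      - (\<Sum>B\<in>P - {A}. esym r B z)" for z
  proof -
    have "esym r V z = esym r (A \<union> (V - A)) z" using AV by (simp add: Un_absorb1)
    also have "\<dots> = (\<Sum>j\<le>r. esym j A z * esym (r - j) (V - A) z)"
      using fA by (intro esym_union) auto
    also have "\<dots> = (\<Sum>j<r. esym j A z * esym (r - j) (V - A) z) + esym r A z"
      using fA by (simp add: lessThan_Suc_atMost[symmetric] esym_0)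
    finally show ?thesis
      using sum.remove[OF fP A, of "\<lambda>B. esym r B z"] by (simp add: cross_poly_def)
  qed
  have "esym j A x * esym (r - j) (V - A) x \<le> esym j A y * esym (r - j) (V - A) y" for j
  proof (rule mult_mono)
    have "esym j A y = (card A choose j) * m ^ j" using fA by (intro esym_const) (auto simp: y_def)
    then show "esym j A x \<le> esym j A y" using maclaurin[OF fA(1), of x j] x AV by (auto simp: m_def)
    show "esym (r - j) (V - A) x \<le> esym (r - j) (V - A) y"
      by (rule eq_refl, rule esym_cong) (auto simp: y_def)
    have "0 \<le> m" unfolding m_def using x AV by (intro divide_nonneg_nonneg sum_nonneg) auto
    then show "0 \<le> esym j A y" by (intro esym_nonneg) (auto simp: y_def)
    show "0 \<le> esym (r - j) (V - A) x" using x by (intro esym_nonneg) auto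
  qed
  then have "(\<Sum>j<r. esym j A x * esym (r - j) (V - A) x) \<le> (\<Sum>j<r. esym j A y * esym (r - j) (V - A) y)"
    by (intro sum_mono)
  moreover have "(\<Sum>B\<in>P - {A}. esym r B x) = (\<Sum>B\<in>P - {A}. esym r B y)"
  proof (intro sum.cong refl esym_cong)
    fix B v assume "B \<in> P - {A}" "v \<in> B"
    then have "v \<notin> A" using P A by (auto simp: partition_on_def disjoint_def)
    then show "x v = y v" by (simp add: y_def)
  qed
  ultimately show ?thesis unfolding split by simp
qed

lemma cross_poly_le_class_constant:
  assumes V: "finite V" and P: "partition_on V P"
    and x: "\<And>v. v \<in> V \<Longrightarrow> 0 \<le> x v" "(\<Sum>v\<in>V. x v) = s"
  obtains y c where "\<forall>v\<in>V. 0 \<le> y v" "(\<Sum>v\<in>V. y v) = s"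
    "cross_poly r V P x \<le> cross_poly r V P y" "\<forall>A\<in>P. \<forall>v\<in>A. y v = c A"
proof -
  have fP: "finite P" using V P by (rule finite_elements)
  \<comment> \<open>\<open>S\<close> collects the classes already made constant; averaging a further
    class leaves them untouched.\<close>
  have "\<exists>y. (\<forall>v\<in>V. 0 \<le> y v) \<and> (\<Sum>v\<in>V. y v) = (\<Sum>v\<in>V. x v) \<and>
      cross_poly r V P x \<le> cross_poly r V P y \<and> (\<forall>A\<in>S. \<exists>c. \<forall>v\<in>A. y v = c)" if "S \<subseteq> P" for S
    using finite_subset[OF that fP] that
  proof (induction S rule: finite_induct)
    case empty
    then show ?case using x by (intro exI[of _ x]) auto
  next
    case (insert A S)
    then obtain y where y: "\<And>v. v \<in> V \<Longrightarrow> 0 \<le> y v" "(\<Sum>v\<in>V. y v) = (\<Sum>v\<in>V. x v)"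
      "cross_poly r V P x \<le> cross_poly r V P y" "\<forall>A\<in>S. \<exists>c. \<forall>v\<in>A. y v = c" by auto
    define z where "z = (\<lambda>v. if v \<in> A then (\<Sum>v\<in>A. y v) / card A else y v)"
    have A: "A \<in> P" using insert.prems by simp
    then have AV: "A \<subseteq> V" "A \<noteq> {}" using P by (auto simp: partition_on_def)
    then have fA: "finite A" "finite (V - A)" "0 < card A" using V finite_subset by (auto simp: card_gt_0_iff)
    have "0 \<le> z v" if "v \<in> V" for v
      using y(1) that AV by (auto simp: z_def intro!: divide_nonneg_nonneg sum_nonneg)
    moreover have "(\<Sum>v\<in>V. z v) = (\<Sum>v\<in>V. x v)"
    proof -
      have "(\<Sum>v\<in>V. z v) = (\<Sum>v\<in>V - A. z v) + (\<Sum>v\<in>A. z v)" using V AV by (intro sum.subset_diff)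
      also have "(\<Sum>v\<in>V - A. z v) = (\<Sum>v\<in>V - A. y v)" by (intro sum.cong) (auto simp: z_def)
      also have "(\<Sum>v\<in>A. z v) = (\<Sum>v\<in>A. y v)" using fA by (simp add: z_def)
      also have "(\<Sum>v\<in>V - A. y v) + (\<Sum>v\<in>A. y v) = (\<Sum>v\<in>V. y v)"
        using V AV by (intro sum.subset_diff[symmetric])
      finally show ?thesis using y(2) by simp
    qed
    moreover have "cross_poly r V P x \<le> cross_poly r V P z"
      unfolding z_def using y(1) by (intro order_trans[OF y(3) cross_poly_le_average[OF V P A]])
    moreover have "\<exists>c. \<forall>v\<in>B. z v = c" if "B \<in> insert A S" for B
    proof (cases "B = A")
      case True
      then show ?thesis by (auto simp: z_def)
    next
      case False
      then have "B \<inter> A = {}" using that A P insert.prems by (auto simp: partition_on_def disjoint_def)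
      then have "z v = y v" if "v \<in> B" for v using that by (auto simp: z_def)
      then show ?thesis using y(4) False that by auto
    qed
    ultimately show ?case by (intro exI[of _ z]) auto
  qed
  from this[of P] obtain y where y: "\<forall>v\<in>V. 0 \<le> y v" "(\<Sum>v\<in>V. y v) = (\<Sum>v\<in>V. x v)"
      "cross_poly r V P x \<le> cross_poly r V P y" "\<forall>A\<in>P. \<exists>c. \<forall>v\<in>A. y v = c" by auto
  from y(4) obtain c where "\<forall>A\<in>P. \<forall>v\<in>A. y v = c A" by metis
  with y x(2) show thesis by (intro that[of y c]) auto
qed

section \<open>Bounds for weights constant on classes\<close>

text \<open>Bernoulli's inequality is the tangent to the \<open>r\<close>-th power at
  \<open>w\<close>. Keeping \<open>w\<close> free allows a tangent point other than the
  mean.\<close>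

lemma sum_power_ge_tangent:
  fixes c :: "'b \<Rightarrow> real"
  assumes "finite S" "S \<noteq> {}" "\<And>i. i \<in> S \<Longrightarrow> 0 \<le> c i" "0 < w"
  shows "card S * (w ^ r * (1 + r * ((\<Sum>i\<in>S. c i) / card S / w - 1))) \<le> (\<Sum>i\<in>S. c i ^ r)"
proof -
  have card: "0 < card S" using assms by (simp add: card_gt_0_iff)
  have "w ^ r * (1 + r * (c i / w - 1)) \<le> c i ^ r" if "i \<in> S" for i
  proof -
    have "w ^ r * (1 + r * (c i / w - 1)) \<le> w ^ r * (1 + (c i / w - 1)) ^ r"
      using assms that by (intro mult_left_mono Bernoulli_inequality) auto
    then show ?thesis using assms(4) by (simp add: power_divide)
  qed
  then have "(\<Sum>i\<in>S. w ^ r * (1 + r * (c i / w - 1))) \<le> (\<Sum>i\<in>S. c i ^ r)" by (rule sum_mono)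
  moreover have "(\<Sum>i\<in>S. w ^ r * (1 + r * (c i / w - 1))) 
      = w ^ r * (card S + r * ((\<Sum>i\<in>S. c i) / w - card S))"
    by (simp add: sum_distrib_left[symmetric] sum.distrib sum_subtractf sum_divide_distrib)
  moreover have "\<dots> = card S * (w ^ r * (1 + r * ((\<Sum>i\<in>S. c i) / card S / w - 1)))"
    using card assms(4) by (simp add: field_simps)
  ultimately show ?thesis by simp
qed

text \<open>Cauchy-Schwarz; it passes from individual class weights to the averages
  \<open>\<alpha>\<close> and \<open>\<beta>\<close> in the variance.\<close>

lemma sum_square_dev_ge:
  fixes c :: "'b \<Rightarrow> real"
  assumes "finite S" "S \<noteq> {}"
  shows "card S * ((\<Sum>i\<in>S. c i) / card S - a)^2 \<le> (\<Sum>i\<in>S. (c i - a)^2)"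
proof -
  have card: "0 < card S" using assms by (simp add: card_gt_0_iff)
  have "(\<Sum>i\<in>S. c i - a)^2 \<le> card S * (\<Sum>i\<in>S. (c i - a)^2)"
    using Cauchy_Schwarz_ineq_sum[of "\<lambda>_. 1" "\<lambda>i. c i - a" S] by simp
  moreover have "(\<Sum>i\<in>S. c i - a) = card S * ((\<Sum>i\<in>S. c i) / card S - a)"
    using card by (simp add: sum_subtractf right_diff_distrib)
  ultimately have "card S * (card S * ((\<Sum>i\<in>S. c i) / card S - a)^2) \<le> card S * (\<Sum>i\<in>S. (c i - a)^2)"
    by (simp only: power_mult_distrib power2_eq_square mult_ac)
  then show ?thesis by (rule mult_left_le_imp_le) (use card in simp)
qed

lemma balanced_partition_sizes:
  assumes V: "finite V" and P: "partition_on V P" and k: "0 < card P"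
    and bal: "\<And>A B. A \<in> P \<Longrightarrow> B \<in> P \<Longrightarrow> card A \<le> card B + 1"
  obtains q t where "card V = card P * q + t" "t < card P"
    "card {A \<in> P. card A = q} = card P - t" "card {A \<in> P. card A = Suc q} = t"
    "\<And>A. A \<in> P \<Longrightarrow> card A = q \<or> card A = Suc q"
proof -
  have fP: "finite P" using V P by (rule finite_elements)
  \<comment> \<open>The minimum is attained, so some class has size \<open>q\<close>; this gives
    \<open>t < card P\<close>.\<close>
  define q where "q = Min (card ` P)"
  have ne: "card ` P \<noteq> {}" using k by auto
  have "q \<in> card ` P" unfolding q_def using fP ne by (intro Min_in) auto
  then obtain B where B: "B \<in> P" "card B = q" by auto
  have sz: "card A = q \<or> card A = Suc q" if "A \<in> P" for A
  proof -
    have "q \<le> card A" unfolding q_def using fP that by (intro Min_le) auto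
    then show ?thesis using bal[OF that B(1)] B(2) by linarith
  qed
  let ?P0 = "{A \<in> P. card A = q}" and ?P1 = "{A \<in> P. card A = Suc q}"
  have un: "P = ?P0 \<union> ?P1" using sz by auto
  have f: "finite ?P0" "finite ?P1" using fP by auto
  have c: "card P = card ?P0 + card ?P1"
    by (subst un, rule card_Un_disjoint) (use f in auto)
  have "0 < card ?P0" using B f by (auto simp: card_gt_0_iff)
  have "card V = (\<Sum>A\<in>P. card A)"
    using P finite_class[OF V P] by (rule product_partition)
  also have "\<dots> = (\<Sum>A\<in>?P0. card A) + (\<Sum>A\<in>?P1. card A)"
    by (subst un, rule sum.union_disjoint) (use f in auto)
  also have "\<dots> = card P * q + card ?P1" unfolding c by (simp add: algebra_simps)
  finally show thesis using c \<open>0 < card ?P0\<close> sz by (intro that[of q "card ?P1"]) auto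
qed

lemma cross_poly_class_constant_bound:
  assumes V: "finite V" and P: "partition_on V P" and k: "card P = k" "2 \<le> k"
    and bal: "\<And>A B. A \<in> P \<Longrightarrow> B \<in> P \<Longrightarrow> card A \<le> card B + 1"
    and r: "4 \<le> r" and n: "card V = n" "(r - 1) * k < n"
    and y: "\<And>v. v \<in> V \<Longrightarrow> 0 \<le> y v" "(\<Sum>v\<in>V. y v) = n"
    and c: "\<And>A v. A \<in> P \<Longrightarrow> v \<in> A \<Longrightarrow> y v = c A"
  shows "cross_poly r V P y \<le> (n choose r) - k * (real n / k gchoose r)"
    and "\<not> k dvd n \<Longrightarrow> cross_poly r V P y < (n choose r) - k * (real n / k gchoose r)"
proof -
  have fP: "finite P" using V P by (rule finite_elements)
  have fA: "finite A" "A \<noteq> {}" if "A \<in> P" for A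
    using that P finite_class[OF V P] by (auto simp: partition_on_def)
  have c0: "0 \<le> c A" if A: "A \<in> P" for A
  proof -
    obtain v where "v \<in> A" using fA(2)[OF A] by auto
    moreover then have "v \<in> V" using A P by (auto simp: partition_on_def)
    ultimately show ?thesis using c[OF A] y(1) by metis
  qed
  have class_sum: "(\<Sum>v\<in>V. f (y v)) = (\<Sum>A\<in>P. card A * f (c A))" for f :: "real \<Rightarrow> real"
    unfolding sum_partition_on[OF V P] using c by (intro sum.cong) auto
  have esymA: "esym r A y = (card A choose r) * c A ^ r" if "A \<in> P" for A
    using fA c that by (intro esym_const) auto
  define d where "d = (\<Sum>v\<in>V. (y v - 1)^2) / (n * (real n - 1))"
  have n2: "2 \<le> n"
  proof -
    have "3 * 2 \<le> (r - 1) * k" using r k by (intro mult_le_mono) auto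
    then show ?thesis using n by linarith
  qed
  have d1: "d \<le> 1" and ed: "esym r V y \<le> (n choose r) * (1 - d)^(r - 1)"
    using esym_le_variance(1)[of V y] esym_le_variance(2)[of V y r] V y n n2 r by (auto simp: d_def)
  have dv: "n * (real n - 1) * d = (\<Sum>A\<in>P. card A * (c A - 1)^2)"
    using n2 class_sum[of "\<lambda>z. (z - 1)^2"] by (simp add: d_def)
  have dnn: "0 \<le> d" unfolding d_def using n2 by (intro divide_nonneg_nonneg sum_nonneg) auto
  obtain q t where qt: "n = k * q + t" "t < k" and
    cards: "card {A \<in> P. card A = q} = k - t" "card {A \<in> P. card A = Suc q} = t" and
    sz: "\<And>A. A \<in> P \<Longrightarrow> card A = q \<or> card A = Suc q"
    using balanced_partition_sizes[OF V P _ bal] k n by auto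
  define P0 where "P0 = {A \<in> P. card A = q}"
  define P1 where "P1 = {A \<in> P. card A = Suc q}"
  have un: "P = P0 \<union> P1" "P0 \<inter> P1 = {}" "finite P0" "finite P1"
    using sz fP by (auto simp: P0_def P1_def)
  have card0: "card P0 = k - t" and card1: "card P1 = t" using cards by (auto simp: P0_def P1_def)
  have ne0: "P0 \<noteq> {}" using card0 qt by auto
  have split: "(\<Sum>A\<in>P. f (card A) A) = (\<Sum>A\<in>P0. f q A) + (\<Sum>A\<in>P1. f (Suc q) A)" for f :: "nat \<Rightarrow> 'a set \<Rightarrow> real"
  proof -
    have "(\<Sum>A\<in>P. f (card A) A) = (\<Sum>A\<in>P0. f (card A) A) + (\<Sum>A\<in>P1. f (card A) A)"
      by (subst un(1), rule sum.union_disjoint) (use un in auto)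
    then show ?thesis by (simp add: P0_def P1_def)
  qed
  \<comment> \<open>Otherwise \<open>n < Suc q * k \<le> (r - 1) * k\<close>.\<close>
  have q: "r \<le> Suc q"
  proof (rule ccontr)
    assume "\<not> r \<le> Suc q"
    then have "Suc q * k \<le> (r - 1) * k" by (intro mult_right_mono) auto
    then show False using n(2) qt by (simp add: algebra_simps)
  qed
  have q0: "0 < q" using q r by simp
  define S0 where "S0 = (\<Sum>A\<in>P0. c A)"
  define S1 where "S1 = (\<Sum>A\<in>P1. c A)"
  have tot: "q * S0 + (q + 1) * S1 = n"
    using class_sum[of "\<lambda>z. z"] y(2) split[of "\<lambda>m A. m * c A"]
    by (simp add: S0_def S1_def sum_distrib_left[symmetric] sum.distrib algebra_simps)
  have cross: "cross_poly r V P y = esym r V y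
      - ((q choose r) * (\<Sum>A\<in>P0. c A ^ r) + ((q + 1) choose r) * (\<Sum>A\<in>P1. c A ^ r))"
    using esymA split[of "\<lambda>m A. (m choose r) * c A ^ r"]
    by (simp add: cross_poly_def sum_distrib_left del: binomial_Suc_Suc)
  have c0': "0 \<le> c A" if "A \<in> P0 \<or> A \<in> P1" for A using that c0 un by auto
  have tangent0: "(real k - t) * (w ^ r * (1 + r * (S0 / (real k - t) / w - 1))) \<le> (\<Sum>A\<in>P0. c A ^ r)"
    if "0 < w" for w
    using sum_power_ge_tangent[OF un(3) ne0, of c w r] c0' that qt card0
    by (simp add: S0_def of_nat_diff)
  show strict: "cross_poly r V P y < (n choose r) - k * (real n / k gchoose r)" if nd: "\<not> k dvd n"
  proof -
    have t: "0 < t" using nd qt by (cases t) auto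
    then have ne1: "P1 \<noteq> {}" using card1 by auto
    define \<alpha> where "\<alpha> = S0 / (real k - t)"
    define \<beta> where "\<beta> = S1 / t"
    have kt: "0 < real k - t" using qt by simp
    define \<nu> where "\<nu> = real n / k"
    have \<nu>: "0 < \<nu>" using n2 k by (simp add: \<nu>_def)
    have tangent1: "t * (w ^ r * (1 + r * (\<beta> / w - 1))) \<le> (\<Sum>A\<in>P1. c A ^ r)"
      if "0 < w" for w
      using sum_power_ge_tangent[OF un(4) ne1, of c w r] c0' that card1
      by (simp add: S1_def \<beta>_def)
    have "(real k - t) * (q * (\<alpha> - 1)) + t * ((q + 1) * (\<beta> - 1))
        = (q * S0 + (q + 1) * S1) - (real k * q + t)"
      using kt t by (simp add: \<alpha>_def \<beta>_def field_simps)
    then have mean: "(real k - t) * (q * (\<alpha> - 1)) + t * (real (q + 1) * (\<beta> - 1)) = 0"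
      unfolding tot qt(1) by simp
    have v0: "(real k - t) * (\<alpha> - 1)^2 \<le> (\<Sum>A\<in>P0. (c A - 1)^2)"
      using sum_square_dev_ge[OF un(3) ne0, of c 1] qt card0 by (simp add: S0_def \<alpha>_def of_nat_diff)
    have v1: "t * (\<beta> - 1)^2 \<le> (\<Sum>A\<in>P1. (c A - 1)^2)"
      using sum_square_dev_ge[OF un(4) ne1, of c 1] card1 by (simp add: S1_def \<beta>_def)
    have "(real k - t) * (q * (\<alpha> - 1)^2) + t * ((q + 1) * (\<beta> - 1)^2)
        \<le> q * (\<Sum>A\<in>P0. (c A - 1)^2) + (q + 1) * (\<Sum>A\<in>P1. (c A - 1)^2)"
      using mult_left_mono[OF v0, of q] mult_left_mono[OF v1, of "q + 1"] by (simp add: algebra_simps)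
    also have "\<dots> = n * (real n - 1) * d"
      unfolding dv using split[of "\<lambda>m A. m * (c A - 1)^2"] by (simp add: sum_distrib_left algebra_simps)
    finally have var: "(real k - t) * (q * (\<alpha> - 1)^2) + t * (real (q + 1) * (\<beta> - 1)^2) \<le> n * (real n - 1) * d" by simp
    have be0: "0 \<le> \<beta>" unfolding \<beta>_def S1_def using c0' by (intro divide_nonneg_nonneg sum_nonneg) auto
    \<comment> \<open>The tangent points \<open>\<nu> / q\<close> and \<open>\<nu> / (q + 1)\<close>
      give every class the same mass \<open>\<nu>\<close>.\<close>
    have "(q choose r) * ((real k - t) * ((\<nu> / q) ^ r * (1 + r * (\<alpha> / (\<nu> / q) - 1))))
        \<le> (q choose r) * (\<Sum>A\<in>P0. c A ^ r)"
      using tangent0[of "\<nu> / q"] \<nu> q0 by (intro mult_left_mono) (auto simp: \<alpha>_def)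
    moreover have "((q + 1) choose r) * (t * ((\<nu> / (q + 1)) ^ r * (1 + r * (\<beta> / (\<nu> / (q + 1)) - 1))))
        \<le> ((q + 1) choose r) * (\<Sum>A\<in>P1. c A ^ r)"
      using tangent1[of "\<nu> / (q + 1)"] \<nu> q0 by (intro mult_left_mono) auto
    ultimately have "cross_poly r V P y \<le> (n choose r) * (1 - d)^(r - 1)
       - ((real k - t) * ((q choose r) * ((\<nu> / q)^r * (1 + r * (q * \<alpha> / \<nu> - 1))))
          + t * (((q + 1) choose r) * ((\<nu> / (q + 1))^r * (1 + r * ((q + 1) * \<beta> / \<nu> - 1)))))"
      using ed unfolding cross by (simp add: mult_ac del: binomial_Suc_Suc)
    also have "\<dots> < (n choose r) - k * (\<nu> gchoose r)"
      using unbalanced_bound[OF r q t qt(2) be0 d1 mean] var unfolding \<nu>_def qt(1) by simp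
    finally show ?thesis by (simp add: \<nu>_def)
  qed
  show "cross_poly r V P y \<le> (n choose r) - k * (real n / k gchoose r)"
  proof (cases "t = 0")
    case True
    then have "P1 = {}" using card1 un by simp
    then have S: "S0 = k" using tot qt True q0 by (simp add: S1_def)
    \<comment> \<open>With equal class sizes the mean class weight is 1, so the linear term of the
      tangent at 1 vanishes. The variance factor can then be bounded by 1.\<close>
    have "real k \<le> (\<Sum>A\<in>P0. c A ^ r)" using tangent0[of 1] S True k by simp
    then have "(q choose r) * real k \<le> (q choose r) * (\<Sum>A\<in>P0. c A ^ r)"
      by (intro mult_left_mono) auto
    moreover have "esym r V y \<le> n choose r"
    proof -
      have "(n choose r) * (1 - d)^(r - 1) \<le> real (n choose r) * 1"
        using d1 dnn by (intro mult_left_mono power_le_one) auto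
      then show ?thesis using ed by simp
    qed
    moreover have "real n / k = q" using qt True k by simp
    ultimately show ?thesis unfolding cross using \<open>P1 = {}\<close>
      by (simp add: binomial_gbinomial[symmetric] mult.commute)
  next
    case False
    then have "\<not> k dvd n" using qt by (simp add: dvd_add_right_iff nat_dvd_not_less)
    then show ?thesis using strict by simp
  qed
qed

lemma cross_poly_bound:
  assumes V: "finite V" and P: "partition_on V P" and k: "card P = k" "2 \<le> k"
    and bal: "\<And>A B. A \<in> P \<Longrightarrow> B \<in> P \<Longrightarrow> card A \<le> card B + 1"
    and r: "4 \<le> r" and n: "card V = n" "(r - 1) * k < n"
    and x: "\<And>v. v \<in> V \<Longrightarrow> 0 \<le> x v" "(\<Sum>v\<in>V. x v) = n"
  shows "cross_poly r V P x \<le> (n choose r) - k * (real n / k gchoose r)"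
    and "\<not> k dvd n \<Longrightarrow> cross_poly r V P x < (n choose r) - k * (real n / k gchoose r)"
proof -
  obtain y :: "'a \<Rightarrow> real" and c where y: "\<forall>v\<in>V. 0 \<le> y v" "(\<Sum>v\<in>V. y v) = n"
    "cross_poly r V P x \<le> cross_poly r V P y" "\<forall>A\<in>P. \<forall>v\<in>A. y v = c A"
    by (rule cross_poly_le_class_constant[where r = r and x = x, OF V P x])
  note b = cross_poly_class_constant_bound[where y = y and c = c, OF V P k bal r n y(1)[rule_format] y(2) y(4)[rule_format]]
  show "cross_poly r V P x \<le> (n choose r) - k * (real n / k gchoose r)"
    using b(1) y(3) by simp
  show "\<not> k dvd n \<Longrightarrow> cross_poly r V P x < (n choose r) - k * (real n / k gchoose r)"
    using b(2) y(3) by simp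
qed

section \<open>Scaling and the power mean inequality\<close>

lemma cross_poly_scale: "cross_poly r V P (\<lambda>v. c * x v) = c ^ r * cross_poly r V P x"
  by (simp add: cross_poly_def esym_scale sum_distrib_left algebra_simps)

text \<open>Bernoulli's inequality for a real exponent, from Young's inequality for
  \<open>t powr p\<close> and 1 with weights \<open>1 / p\<close> and
  \<open>1 - 1 / p\<close>.\<close>

lemma powr_ge_tangent:
  fixes t p :: real
  assumes "1 \<le> p" "0 \<le> t"
  shows "1 + p * (t - 1) \<le> t powr p"
proof (cases "t = 0")
  case False
  then have "(t powr p) powr (1 / p) * 1 powr (1 - 1 / p) \<le> (1 / p) * t powr p + (1 - 1 / p) * 1"
    using assms by (intro Youngs_inequality_0) auto
  then have "t \<le> t powr p / p + (1 - 1 / p)" using assms False by (simp add: powr_powr)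
  then have "t * p \<le> (t powr p / p + (1 - 1 / p)) * p" using assms by (intro mult_right_mono) auto
  also have "\<dots> = t powr p + p - 1" using assms by (simp add: field_simps)
  finally show ?thesis by (simp add: algebra_simps)
qed (use assms in simp)

text \<open>Summing the tangents at the mean \<open>w\<close> cancels the linear terms and leaves
  \<open>card V * w powr p \<le> 1\<close>.\<close>

lemma power_mean_le:
  fixes x :: "'a \<Rightarrow> real" and p :: real
  assumes "finite V" "V \<noteq> {}" "1 \<le> p" "\<And>v. v \<in> V \<Longrightarrow> 0 \<le> x v"
    "(\<Sum>v\<in>V. x v powr p) = 1"
  shows "(\<Sum>v\<in>V. x v) / card V \<le> real (card V) powr (- (1 / p))"
proof -
  define w where "w = (\<Sum>v\<in>V. x v) / card V"
  define n where "n = real (card V)"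
  have n: "0 < n" using assms by (simp add: n_def card_gt_0_iff)
  have "0 \<le> w" unfolding w_def using assms by (intro divide_nonneg_nonneg sum_nonneg) auto
  show ?thesis
  proof (cases "w = 0")
    case True
    show ?thesis unfolding w_def[symmetric] True by simp
  next
    case False
    then have w: "0 < w" using \<open>0 \<le> w\<close> by simp
    have "w powr p * (1 + p * (x v / w - 1)) \<le> x v powr p" if "v \<in> V" for v
    proof -
      have "w powr p * (1 + p * (x v / w - 1)) \<le> w powr p * (x v / w) powr p"
        using assms w that by (intro mult_left_mono powr_ge_tangent) auto
      also have "\<dots> = x v powr p" using w assms that by (simp add: powr_divide)
      finally show ?thesis .
    qed
    then have "(\<Sum>v\<in>V. w powr p * (1 + p * (x v / w - 1))) \<le> 1"
      unfolding assms(5)[symmetric] by (rule sum_mono)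
    also have "(\<Sum>v\<in>V. w powr p * (1 + p * (x v / w - 1))) = w powr p * (n + p * ((\<Sum>v\<in>V. x v) / w - n))"
      by (simp add: sum_distrib_left[symmetric] sum.distrib sum_subtractf sum_divide_distrib n_def)
    also have "(\<Sum>v\<in>V. x v) / w - n = 0" using w n by (auto simp: w_def n_def)
    finally have "w powr p \<le> 1 / n" using n by (simp add: field_simps)
    then have "(w powr p) powr (1 / p) \<le> (1 / n) powr (1 / p)"
      using assms by (intro powr_mono2) auto
    then have "w \<le> n powr (- (1 / p))"
      using w n assms(3) by (simp add: powr_powr powr_divide powr_minus_divide)
    then show ?thesis unfolding w_def n_def .
  qed
qed

section \<open>The spectral radius\<close>

theorem theorem1p4:
  fixes r k n :: nat and p :: real and G :: "'a hypergraph"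
  assumes "r \<ge> 4" and "k \<ge> 2" and "n > (r - 1) * k" and "p \<ge> 1"
    and "is_Q r k n G"
  shows "let bound = fact r * (real (n choose r) - real k * ((real n / real k) gchoose r))
                       * real n powr (- (real r / p))
         in p_spectral_radius r p G \<le> bound
            \<and> (k dvd n \<longrightarrow> p_spectral_radius r p G = bound)
            \<and> (\<not> k dvd n \<longrightarrow> p_spectral_radius r p G < bound)"
proof -
  define V where "V = fst G"
  obtain P where V: "finite V" "card V = n" and P: "partition_on V P" "card P = k"
    and balanced: "\<forall>A\<in>P. \<forall>B\<in>P. card A \<le> card B + 1"
    and E: "snd G = {e. e \<subseteq> V \<and> card e = r \<and> \<not> (\<exists>A\<in>P. e \<subseteq> A)}"
    using assms(5) unfolding is_Q_def V_def[symmetric] by (elim conjE exE)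
  have bal: "card A \<le> card B + 1" if "A \<in> P" "B \<in> P" for A B
    using balanced that by blast
  have n0: "0 < n" using assms(3) by simp
  then have Vne: "V \<noteq> {}" using V by auto
  have poly: "hypergraph_poly r G x = fact r * cross_poly r V P x" for x
    using hypergraph_poly_eq_cross_poly[OF V(1) P(1), of r x] assms(1) E
    by (metis V_def less_le_trans prod.collapse zero_less_numeral)
  define B where "B = real (n choose r) - real k * ((real n / real k) gchoose r)"
  define N where "N = real n powr (- (1 / p))"
  have N: "0 < N" using n0 by (simp add: N_def)
  have Nr: "real n powr (- (real r / p)) = N ^ r"
    using n0 by (simp add: N_def powr_realpow[symmetric] powr_powr)
  have bound: "cross_poly r V P z \<le> B" "\<not> k dvd n \<Longrightarrow> cross_poly r V P z < B"
    if "\<And>v. v \<in> V \<Longrightarrow> 0 \<le> z v" "(\<Sum>v\<in>V. z v) = n" for z :: "'a \<Rightarrow> real"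
    unfolding B_def using cross_poly_bound[of V P k r n z] V P bal assms(1-3) that by auto
  have one: "cross_poly r V P (\<lambda>_. 1) \<le> B"
    by (rule bound(1)) (use V in auto)
  \<comment> \<open>The all-one vector shows \<open>0 \<le> B\<close>, so that
    \<open>s ^ r * B\<close> can be enlarged to \<open>N ^ r * B\<close>.\<close>
  have "0 \<le> hypergraph_poly r G (\<lambda>_. 1)"
    by (simp add: hypergraph_poly_def)
  then have "0 \<le> cross_poly r V P (\<lambda>_. 1)"
    unfolding poly using fact_gt_zero[of r, where ?'a = real]
    by (simp add: zero_le_mult_iff del: fact_gt_zero)
  then have B: "0 \<le> B" using one by simp
  have unif: "uniform_hypergraph r G" using assms(5) by (rule is_Q_uniform)
  have p0: "0 < p" using assms(4) by simp
  \<comment> \<open>Working at a maximiser carries the strict bound over to the supremum.\<close>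
  obtain x where x: "(\<Sum>v\<in>V. \<bar>x v\<bar> powr p) = 1"
    "p_spectral_radius r p G = hypergraph_poly r G x"
    using p_spectral_radius_attained(1)[OF unif _ p0] Vne unfolding V_def by blast
  \<comment> \<open>The factor \<open>s\<close> normalises the absolute values of \<open>x\<close>
    to a vector \<open>y\<close> of total mass \<open>n\<close>, as \<open>cross_poly_bound\<close>
    requires.\<close>
  define s where "s = (\<Sum>v\<in>V. \<bar>x v\<bar>) / n"
  define y where "y v = \<bar>x v\<bar> / s" for v
  have "\<exists>v\<in>V. x v \<noteq> 0"
  proof (rule ccontr)
    assume "\<not> ?thesis"
    then have "(\<Sum>v\<in>V. \<bar>x v\<bar> powr p) = 0" by (intro sum.neutral) auto
    then show False using x(1) by simp
  qed
  then have "0 < (\<Sum>v\<in>V. \<bar>x v\<bar>)" using V(1) by (auto intro: sum_pos2)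
  then have s: "0 < s" using n0 by (simp add: s_def)
  have sN: "s \<le> N"
    using power_mean_le[of V p "\<lambda>v. \<bar>x v\<bar>"] V Vne assms(4) x(1) by (simp add: s_def N_def)
  have "(\<Sum>v\<in>V. y v) = (\<Sum>v\<in>V. \<bar>x v\<bar>) / s" by (simp add: y_def sum_divide_distrib)
  also have "\<dots> = n" using s n0 by (auto simp: s_def)
  finally have y: "\<And>v. v \<in> V \<Longrightarrow> 0 \<le> y v" "(\<Sum>v\<in>V. y v) = n"
    using s by (auto simp: y_def)
  have "hypergraph_poly r G x \<le> hypergraph_poly r G (\<lambda>v. s * y v)"
    unfolding hypergraph_poly_def
  proof (intro mult_left_mono sum_mono)
    fix e
    have "(\<Prod>v\<in>e. x v) \<le> \<bar>\<Prod>v\<in>e. x v\<bar>" by simp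
    also have "\<dots> = (\<Prod>v\<in>e. s * y v)" using s by (simp add: abs_prod y_def)
    finally show "(\<Prod>v\<in>e. x v) \<le> (\<Prod>v\<in>e. s * y v)" .
  qed simp
  also have "\<dots> = fact r * (s ^ r * cross_poly r V P y)" by (simp add: poly cross_poly_scale)
  finally have le: "p_spectral_radius r p G \<le> fact r * (s ^ r * cross_poly r V P y)"
    using x(2) by simp
  have sB: "s ^ r * B \<le> N ^ r * B" using s sN B by (intro mult_right_mono power_mono) auto
  have upper: "p_spectral_radius r p G \<le> fact r * B * N ^ r"
  proof -
    have "s ^ r * cross_poly r V P y \<le> s ^ r * B" using bound(1)[of y] y s by (intro mult_left_mono) auto
    then have "fact r * (s ^ r * cross_poly r V P y) \<le> fact r * (N ^ r * B)"
      using sB by (intro mult_left_mono) auto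
    from order_trans[OF le this] show ?thesis by (simp only: mult_ac)
  qed
  have strict: "p_spectral_radius r p G < fact r * B * N ^ r" if "\<not> k dvd n"
  proof -
    have "s ^ r * cross_poly r V P y < s ^ r * B"
      using bound(2)[of y] y that s by (intro mult_strict_left_mono) auto
    then have "fact r * (s ^ r * cross_poly r V P y) < fact r * (N ^ r * B)"
      using sB by (intro mult_strict_left_mono) auto
    from order_le_less_trans[OF le this] show ?thesis by (simp only: mult_ac)
  qed
  \<comment> \<open>The constant vector with value \<open>N\<close> is admissible and attains the
    bound.\<close>
  have eq: "p_spectral_radius r p G = fact r * B * N ^ r" if dvd: "k dvd n"
  proof -
    have k0: "0 < card P" using P assms(2) by simp
    obtain q t where qt: "card V = card P * q + t" "t < card P"
      "card {A \<in> P. card A = q} = card P - t" "card {A \<in> P. card A = Suc q} = t"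
      and sz: "\<And>A. A \<in> P \<Longrightarrow> card A = q \<or> card A = Suc q"
      using balanced_partition_sizes[OF V(1) P(1) k0 bal] by auto
    have t: "t = 0" using dvd qt V P by (auto simp: dvd_add_right_iff dest: nat_dvd_not_less)
    have fP: "finite P" using V(1) P(1) by (rule finite_elements)
    have "card A = q" if "A \<in> P" for A
      using sz[OF that] qt(4) t fP that by auto
    then have "esym r A (\<lambda>_. 1) = q choose r" if "A \<in> P" for A
      using esym_const[OF finite_class[OF V(1) P(1) that], of "\<lambda>_. 1" 1 r] that by simp
    then have "cross_poly r V P (\<lambda>_. 1) = real (n choose r) - real k * real (q choose r)"
      using esym_const[OF V(1), of "\<lambda>_. 1" 1 r] V P by (simp add: cross_poly_def)
    also have "\<dots> = B"
    proof -
      have "real n / k = q" using qt(1) t V P assms(2) by simp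
      then show ?thesis by (simp add: B_def binomial_gbinomial)
    qed
    finally have cross: "cross_poly r V P (\<lambda>v. N * 1) = N ^ r * B" unfolding cross_poly_scale by simp
    have "(\<Sum>v\<in>V. \<bar>N * 1\<bar> powr p) = 1"
    proof -
      have "N powr p = real n powr (-1)" using assms(4) by (simp add: N_def powr_powr)
      then show ?thesis using N V n0 by (simp add: powr_minus_divide)
    qed
    then have "hypergraph_poly r G (\<lambda>v. N * 1) \<le> p_spectral_radius r p G"
      using p_spectral_radius_attained(2)[OF unif _ p0, of "\<lambda>v. N * 1"] Vne unfolding V_def by blast
    then show ?thesis using upper unfolding poly cross by (simp add: mult_ac)
  qed
  show ?thesis unfolding Let_def Nr B_def[symmetric] using upper strict eq by blast
qed

end
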